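(* For every natural number $d>1$ the number $\mathfrak{c}_d^{\mathrm{pol}}$ is finite, and $$\mathfrak{c}_d^{\mathrm{pol}}\le O\bigl(d^5\bigr)\Bigl(\tfrac32\Bigr)^{\lceil\sqrt{d-1}\,\rceil(d-1)},$$ i.e. there is an absolute constant $K>0$ such that $\mathfrak{c}_d^{\mathrm{pol}}\le K\,d^5\,(3/2)^{\lceil\sqrt{d-1}\rceil(d-1)}$ for all $d>1$.
   Context: A lattice polytope in $\mathbb{R}^d$ is a convex polytope whose vertices lie in $\mathbb{Z}^d$. For $c\ge 0$, $cP$ denotes the image of $P$ under the dilatation with factor $c$ and center the origin $O$. For a lattice simplex with vertices $v_0,\dots,v_e$, its multiplicity is the index of the subgroup $U$ generated by $v_1-v_0,\dots,v_e-v_0$ in the smallest direct summand of $\mathbb{Z}^d$ containing $U$; a lattice simplex is unimodular if its multiplicity is $1$. For a $d$-polytope $P\subset\mathbb{R}^d$, $\mathrm{UC}(P)$ is the union of all unimodular lattice $d$-simplices contained in $P$. $\mathfrak{c}_d^{\mathrm{pol}}$ is the infimum of natural numbers $c$ such that $c'P=\mathrm{UC}(c'P)$ for all lattice $d$-polytopes $P\subset\mathbb{R}^d$ and all natural numbers $c'\ge c$ (a priori possibly $\infty$). *)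

theory Defs
  imports Complex_Main "HOL-Library.Extended_Nat"
begin

text \<open>Points of R^d are represented as functions nat => real vanishing outside {..<d}
  (the dimension d varies inside the statement, so no type-indexed dimension is used).\<close>

definition Rd :: "nat \<Rightarrow> (nat \<Rightarrow> real) set" where
  "Rd d = {x. \<forall>i\<ge>d. x i = 0}"

definition lattice_pts :: "nat \<Rightarrow> (nat \<Rightarrow> real) set" where
  "lattice_pts d = {x \<in> Rd d. \<forall>i<d. x i \<in> \<int>}"

definition conv :: "(nat \<Rightarrow> real) set \<Rightarrow> (nat \<Rightarrow> real) set" where
  "conv V = {x. \<exists>u. (\<forall>v\<in>V. 0 \<le> u v) \<and> (\<Sum>v\<in>V. u v) = 1 \<and>
                      x = (\<lambda>i. \<Sum>v\<in>V. u v * v i)}"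

definition dilate :: "real \<Rightarrow> (nat \<Rightarrow> real) set \<Rightarrow> (nat \<Rightarrow> real) set" where
  "dilate c P = (\<lambda>x. (\<lambda>i. c * x i)) ` P"

definition full_dim :: "nat \<Rightarrow> (nat \<Rightarrow> real) set \<Rightarrow> bool" where
  "full_dim d P \<longleftrightarrow> (\<exists>v0 w. v0 \<in> P \<and> (\<forall>j<d. w j \<in> P) \<and>
      (\<forall>a::nat \<Rightarrow> real. (\<forall>i<d. (\<Sum>j<d. a j * (w j i - v0 i)) = 0) \<longrightarrow> (\<forall>j<d. a j = 0)))"

definition lattice_polytope :: "nat \<Rightarrow> (nat \<Rightarrow> real) set \<Rightarrow> bool" where
  "lattice_polytope d P \<longleftrightarrow> (\<exists>V. finite V \<and> V \<noteq> {} \<and> V \<subseteq> lattice_pts d \<and> P = conv V)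
      \<and> full_dim d P"

text \<open>Unimodular lattice d-simplex with vertices v0, v 0, ..., v (d-1): the vertices are
  lattice points and the group U generated by v j - v0 has index 1 in Z^d (for a
  d-simplex the smallest direct summand of Z^d containing U is Z^d itself), i.e. U = Z^d.\<close>
definition unimodular_simplex :: "nat \<Rightarrow> (nat \<Rightarrow> real) set \<Rightarrow> bool" where
  "unimodular_simplex d S \<longleftrightarrow> (\<exists>v0 v. v0 \<in> lattice_pts d \<and> (\<forall>j<d. v j \<in> lattice_pts d) \<and>
      (\<forall>z\<in>lattice_pts d. \<exists>k::nat \<Rightarrow> int. \<forall>i<d. z i = (\<Sum>j<d. of_int (k j) * (v j i - v0 i))) \<and>
      S = conv (insert v0 (v ` {..<d})))"

definition UC :: "nat \<Rightarrow> (nat \<Rightarrow> real) set \<Rightarrow> (nat \<Rightarrow> real) set" where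
  "UC d P = \<Union> {S. unimodular_simplex d S \<and> S \<subseteq> P}"

definition cpol :: "nat \<Rightarrow> enat" where
  "cpol d = Inf (enat ` {c::nat. \<forall>P. lattice_polytope d P \<longrightarrow>
        (\<forall>c'::nat. c' \<ge> c \<longrightarrow> dilate (real c') P = UC d (dilate (real c') P))})"

end

theory Submission
  imports Defs "HOL-Library.Function_Algebras" "HOL-Real_Asymp.Real_Asymp"
begin

text \<open>
  Covering multiples of polytopes reduces to covering simplicial cones by unimodular cones whose
  generators have bounded weight (sum of coordinates with respect to the generators of the cone).
  In coordinates, let \<open>A \<supseteq> Z^d\<close> be a lattice in \<open>R^d\<close> and \<open>y\<close> a point of the orthant. Star subdivision
  with lattice points of weight less than 1 lets us assume that there are none. Let \<open>y\<^sub>a\<close> be the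
  largest coordinate of \<open>y\<close>. By induction the image of \<open>y\<close> modulo the \<open>a\<close>-axis lies in a unimodular
  cone; its generators are lifted to \<open>A\<close> with \<open>a\<close>-coordinates in \<open>(-1, 0]\<close>, and emptiness bounds the
  absolute values of these by the weights in the quotient. Together with a suitable lattice vector
  the lifts form a unimodular cone around \<open>y\<close> in which \<open>y\<^sub>a\<close> is large, and polynomially many mediants
  make all \<open>a\<close>-coordinates nonnegative. Each dimension thus costs a polynomial factor, so that the
  total weight is \<open>exp (O (d ln d))\<close>, which is dominated by \<open>(3/2) powr ((d - 1) powr (3/2))\<close>.
\<close>

section \<open>Mediants\<close>

definition unit :: "'i \<Rightarrow> 'i \<Rightarrow> real" where
  "unit i = (\<lambda>k. if k = i then 1 else 0)"

text \<open>Only the inclusion of \<open>A\<close> in the integer span is asked for. If the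
  \<open>u i\<close> lie in \<open>A\<close> and \<open>A\<close> is a lattice of rank
  \<open>card I\<close>, this makes them a basis, so that they span a unimodular cone.\<close>

definition generates :: "'i set \<Rightarrow> ('i \<Rightarrow> 'k \<Rightarrow> real) \<Rightarrow> ('k \<Rightarrow> real) set \<Rightarrow> bool" where
  "generates I u A \<longleftrightarrow> (\<forall>z\<in>A. \<exists>c::'i \<Rightarrow> int. \<forall>k. z k = (\<Sum>i\<in>I. of_int (c i) * u i k))"

text \<open>Adding \<open>m\<close> times \<open>u j\<close> to \<open>u i\<close> is undone in a
  linear combination by lowering the coefficient of \<open>u j\<close> by \<open>m * c i\<close>.
  This serves for integer representations, for the coefficients of \<open>y\<close> and for the
  counts alike.\<close>

lemma sum_elementary:
  fixes c :: "'i \<Rightarrow> real" and u :: "'i \<Rightarrow> 'k \<Rightarrow> real"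
  assumes "finite I" "i \<in> I" "j \<in> I" "i \<noteq> j"
  shows "(\<Sum>t\<in>I. (c(j := c j - m * c i)) t * (u(i := (\<lambda>k. u i k + m * u j k))) t k)
       = (\<Sum>t\<in>I. c t * u t k)"
proof -
  have I: "I = insert i (insert j (I - {i, j}))" using assms by auto
  have fin: "finite (I - {i, j})" using assms by auto
  have "(\<Sum>t\<in>I - {i, j}. (c(j := c j - m * c i)) t * (u(i := (\<lambda>k. u i k + m * u j k))) t k)
      = (\<Sum>t\<in>I - {i, j}. c t * u t k)"
    by (rule sum.cong) auto
  then show ?thesis
    using assms fin by (subst (1 2) I) (simp add: algebra_simps)
qed

lemma generates_elementary:
  assumes "finite I" "i \<in> I" "j \<in> I" "i \<noteq> j" "generates I u A"
  shows "generates I (u(i := (\<lambda>k. u i k + of_int m * u j k))) A"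
  unfolding generates_def
proof
  fix z assume "z \<in> A"
  then obtain c :: "'a \<Rightarrow> int" where c: "\<And>k. z k = (\<Sum>i\<in>I. of_int (c i) * u i k)"
    using assms(5) unfolding generates_def by meson
  let ?c = "c(j := c j - m * c i)"
  have *: "real_of_int (?c t) = ((\<lambda>t. real_of_int (c t))(j := of_int (c j) - of_int m * of_int (c i))) t" for t
    by simp
  have "z k = (\<Sum>t\<in>I. of_int (?c t) * (u(i := (\<lambda>k. u i k + of_int m * u j k))) t k)" for k
    unfolding c * by (rule sum_elementary[symmetric]) (use assms in auto)
  then show "\<exists>c::'a \<Rightarrow> int. \<forall>k. z k = (\<Sum>t\<in>I. of_int (c t) * (u(i := (\<lambda>k. u i k + of_int m * u j k))) t k)"
    by blast
qed

lemma closed_multiple: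
  fixes Q :: "nat \<Rightarrow> ('k \<Rightarrow> real) \<Rightarrow> bool"
  assumes add: "\<And>a b v w. Q a v \<Longrightarrow> Q b w \<Longrightarrow> Q (a + b) (\<lambda>k. v k + w k)"
    and "Q a v" "Q b w"
  shows "Q (a + m * b) (\<lambda>k. v k + of_nat m * w k)"
proof (induction m)
  case 0
  then show ?case using assms by simp
next
  case (Suc m)
  from add[OF Suc \<open>Q b w\<close>] show ?case by (simp add: algebra_simps)
qed

text \<open>The coefficient of \<open>u i\<close> in \<open>y\<close> is \<open>s i\<close>, and \<open>l i\<close> counts the initial generators that have been
  added up to form \<open>u i\<close>; \<open>Q l v\<close> stands for properties of \<open>v\<close> that are additive in this count.\<close>
definition mediant_state where
  "mediant_state Q a I A y = (\<lambda>(u :: 'i \<Rightarrow> 'k \<Rightarrow> real, s :: 'i \<Rightarrow> real, l :: 'i \<Rightarrow> nat).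
     (\<forall>i\<in>I. Q (l i) (u i) \<and> 1 \<le> l i \<and> l i \<le> 4 * card I ^ 9 \<and> \<bar>u i a\<bar> \<le> real (card I) \<and> 0 \<le> s i) \<and>
     (\<Sum>i\<in>I. s i * real (l i)) = 1 \<and> (\<forall>k. y k = (\<Sum>i\<in>I. s i * u i k)) \<and> generates I u A)"

text \<open>Since \<open>s i * l i \<le> 1\<close>, generators with large coefficients have small counts. Replacing a generator
  with large coefficient and negative \<open>a\<close>-coordinate, or its positive partner, by their sum therefore
  keeps all counts bounded, while their total grows; a state of maximal total admits no such step.\<close>
lemma mediant_descent:
  fixes u :: "'i \<Rightarrow> 'k \<Rightarrow> real" and Q :: "nat \<Rightarrow> ('k \<Rightarrow> real) \<Rightarrow> bool" and a :: 'k
  assumes fin: "finite I" "I \<noteq> {}"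
    and add: "\<And>a b v w. Q a v \<Longrightarrow> Q b w \<Longrightarrow> Q (a + b) (\<lambda>k. v k + w k)"
    and init: "mediant_state Q a I A y (u, s, l)"
    and ya: "y a \<ge> 1 / real (card I) ^ 2"
  obtains u' s' l' j where "mediant_state Q a I A y (u', s', l')"
    "j \<in> I" "u' j a \<ge> 1 / real (card I) ^ 3" "s' j \<ge> 1 / real (card I) ^ 4" "l' j \<le> card I ^ 4"
    "\<And>i. i \<in> I \<Longrightarrow> u' i a < 0 \<Longrightarrow> s' i < 1 / (2 * real (card I) ^ 9)"
proof -
  define d where "d = card I"
  have d1: "d \<ge> 1" using fin unfolding d_def by (simp add: Suc_le_eq card_gt_0_iff)
  let ?state = "mediant_state Q a I A y"
  have stD: "?state (u, s, l) \<longleftrightarrow> (\<forall>i\<in>I. Q (l i) (u i) \<and> 1 \<le> l i \<and> l i \<le> 4 * d ^ 9 \<and>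
             \<bar>u i a\<bar> \<le> real d \<and> 0 \<le> s i) \<and> (\<Sum>i\<in>I. s i * real (l i)) = 1 \<and>
             (\<forall>k. y k = (\<Sum>i\<in>I. s i * u i k)) \<and> generates I u A" for u s l
    unfolding mediant_state_def d_def by simp
  define meas where "meas = (\<lambda>(u :: 'i \<Rightarrow> 'k \<Rightarrow> real, s :: 'i \<Rightarrow> real, l :: 'i \<Rightarrow> nat). \<Sum>i\<in>I. l i)"
  have bound: "\<forall>x. ?state x \<longrightarrow> meas x < Suc (d * (4 * d ^ 9))"
  proof (intro allI impI)
    fix x assume "?state x"
    then show "meas x < Suc (d * (4 * d ^ 9))"
      by (cases x) (auto simp: stD meas_def d_def less_Suc_eq_le intro!: order_trans[OF sum_bounded_above])
  qed
  obtain X where X: "?state X" "\<And>x. ?state x \<Longrightarrow> meas x \<le> meas X"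
    using ex_has_greatest_nat[of "?state" "(u, s, l)" meas, OF init bound] by blast
  obtain u' s' l' where X': "X = (u', s', l')" by (cases X)
  have st: "?state (u', s', l')" using X X' by simp
  note st' = st[unfolded stD]
  have D1: "real d \<ge> 1" using d1 by simp
  have sl: "s' i * real (l' i) \<le> 1" if "i \<in> I" for i
  proof -
    have "s' i * real (l' i) \<le> (\<Sum>i\<in>I. s' i * real (l' i))"
      using st' that fin by (intro member_le_sum) auto
    then show ?thesis using st' by simp
  qed
  \<comment> \<open>The \<open>d\<close> summands of \<open>y a\<close>, which is at least
    \<open>1 / d ^ 2\<close>, cannot all be below \<open>1 / d ^ 3\<close>.\<close>
  have "\<exists>j\<in>I. s' j * u' j a \<ge> 1 / real d ^ 3"
  proof (rule ccontr)
    assume "\<not> ?thesis"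
    then have "(\<Sum>i\<in>I. s' i * u' i a) < (\<Sum>i\<in>I. 1 / real d ^ 3)"
      using fin by (intro sum_strict_mono) auto
    also have "\<dots> = 1 / real d ^ 2"
      using D1 by (simp add: d_def[symmetric] power2_eq_square power3_eq_cube)
    finally show False using st' ya by (simp add: d_def)
  qed
  then obtain j where j: "j \<in> I" "s' j * u' j a \<ge> 1 / real d ^ 3" by auto
  have j0: "0 \<le> s' j" "\<bar>u' j a\<bar> \<le> d" "1 \<le> real (l' j)" using st' j by auto
  have sj1: "s' j \<le> 1" using sl[OF j(1)] j0 mult_left_mono[of 1 "real (l' j)" "s' j"] by linarith
  have pos: "0 < s' j * u' j a" using j(2) D1 by (smt (verit) divide_pos_pos zero_less_power)
  then have uj0: "u' j a > 0" using j0 by (simp add: zero_less_mult_iff)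
  \<comment> \<open>Splitting the product: \<open>s' j \<le> 1\<close> bounds \<open>u' j a\<close>
    from below, \<open>u' j a \<le> d\<close> bounds \<open>s' j\<close> from below, and then
    \<open>s' j * l' j \<le> 1\<close> bounds \<open>l' j\<close> from above.\<close>
  have uj: "u' j a \<ge> 1 / real d ^ 3"
    using j(2) sj1 uj0 mult_right_mono[of "s' j" 1 "u' j a"] by linarith
  have "s' j * d \<ge> 1 / real d ^ 3"
    using j(2) j0 mult_left_mono[of "u' j a" d "s' j"] by linarith
  then have sj: "s' j \<ge> 1 / real d ^ 4"
    using D1 by (simp add: field_simps power4_eq_xxxx power3_eq_cube)
  have "real (l' j) / real d ^ 4 \<le> 1"
    using sl[OF j(1)] mult_right_mono[OF sj, of "real (l' j)"] by simp
  then have lj': "real (l' j) \<le> real d ^ 4" using D1 by (simp add: field_simps)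
  then have lj: "l' j \<le> d ^ 4" by (metis of_nat_le_iff of_nat_power)
  have "s' i < 1 / (2 * real d ^ 9)" if i: "i \<in> I" "u' i a < 0" for i
  proof (rule ccontr)
    assume "\<not> ?thesis"
    then have si: "s' i \<ge> 1 / (2 * real d ^ 9)" by simp
    have ij: "i \<noteq> j" using i uj0 by auto
    have "real (l' i) / (2 * real d ^ 9) \<le> 1"
      using sl[OF i(1)] mult_right_mono[OF si, of "real (l' i)"] by simp
    then have li: "real (l' i) \<le> 2 * real d ^ 9" using D1 by (simp add: field_simps)
    have "real d ^ 4 \<le> real d ^ 9" using D1 by (intro power_increasing) auto
    then have "real (l' i + l' j) \<le> real (4 * d ^ 9)"
      using li lj' unfolding of_nat_add of_nat_mult of_nat_power of_nat_numeral by linarith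
    then have l4: "l' i + l' j \<le> 4 * d ^ 9" by (simp only: of_nat_le_iff)
    \<comment> \<open>Replacing \<open>u' k\<close> by \<open>u' k + u' m\<close> costs
      \<open>u' m\<close> the coefficient \<open>s' k\<close>. Hence \<open>k\<close> has to be the
      one of \<open>i\<close> and \<open>j\<close> with the smaller coefficient.\<close>
    have step: False if kl: "k \<in> I" "m \<in> I" "k \<noteq> m" "{k, m} = {i, j}" and le: "s' k \<le> s' m" for k m
    proof -
      define u'' where "u'' = u'(k := (\<lambda>t. u' k t + of_int 1 * u' m t))"
      define s'' where "s'' = s'(m := s' m - 1 * s' k)"
      define l'' where "l'' = l'(k := l' k + l' m)"
      have keq: "l' k + l' m = l' i + l' j" "u' k a + u' m a = u' i a + u' j a"
        using kl by (auto simp: doubleton_eq_iff)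
      have gen: "generates I u'' A" unfolding u''_def
        by (rule generates_elementary) (use kl fin st' in auto)
      have yy: "y t = (\<Sum>i\<in>I. s'' i * u'' i t)" for t
        using sum_elementary[OF fin(1) kl(1-3), of s' 1 u' t] st' by (simp add: u''_def s''_def)
      have ll: "(\<Sum>i\<in>I. s'' i * real (l'' i)) = 1"
      proof -
        \<comment> \<open>The counts change exactly as the generators do, so they are treated as
          vectors with a single coordinate.\<close>
        have "(\<Sum>t\<in>I. s'' t * real (l'' t)) = (\<Sum>t\<in>I. s' t * (\<lambda>t k. real (l' t)) t ())"
          unfolding s''_def sum_elementary[OF fin(1) kl(1-3), of s' 1 "\<lambda>t k. real (l' t)" "()", symmetric]
          by (rule sum.cong) (auto simp: l''_def)
        then show ?thesis using st' by simp
      qed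
      have "?state (u'', s'', l'')"
        unfolding stD
      proof (intro conjI ballI allI yy gen ll)
        fix t assume t: "t \<in> I"
        show "Q (l'' t) (u'' t)"
          using st' t kl add[of "l' k" "u' k" "l' m" "u' m"] by (auto simp: l''_def u''_def)
        show "1 \<le> l'' t" using st' t kl by (auto simp: l''_def)
        show "l'' t \<le> 4 * d ^ 9" using st' t kl l4 keq by (auto simp: l''_def)
        \<comment> \<open>The summands \<open>u' i a < 0 < u' j a\<close> have opposite signs, so
          their sum is no larger in absolute value than one of them.\<close>
        show "\<bar>u'' t a\<bar> \<le> real d"
          using st' t j0 i uj0 kl(1,2) keq by (auto simp: u''_def)
        show "0 \<le> s'' t" using st' t le by (auto simp: s''_def)
      qed
      then have "meas (u'', s'', l'') \<le> meas (u', s', l')" using X X' by auto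
      moreover have "(\<Sum>t\<in>I. l' t) < (\<Sum>t\<in>I. l'' t)"
        by (rule sum_strict_mono_ex1) (use fin kl st' in \<open>auto simp: l''_def Suc_le_eq\<close>)
      ultimately show False by (simp add: meas_def)
    qed
    show False
      using step[of i j] step[of j i] i j ij by (metis insert_commute linear)
  qed
  then show ?thesis
    using that[OF st, of j] j uj sj lj unfolding d_def by simp
qed

text \<open>After the descent the remaining negative generators have such small coefficients that suitable
  multiples of one positive generator can be added to all of them at once.\<close>
lemma mediant_refinement:
  fixes u :: "'i \<Rightarrow> 'k \<Rightarrow> real" and Q :: "nat \<Rightarrow> ('k \<Rightarrow> real) \<Rightarrow> bool" and a :: 'k
  assumes fin: "finite I" "I \<noteq> {}"
    and add: "\<And>a b v w. Q a v \<Longrightarrow> Q b w \<Longrightarrow> Q (a + b) (\<lambda>k. v k + w k)"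
    and u: "\<And>i. i \<in> I \<Longrightarrow> Q 1 (u i)" "\<And>i. i \<in> I \<Longrightarrow> \<bar>u i a\<bar> \<le> real (card I)" "generates I u A"
    and s: "\<And>i. i \<in> I \<Longrightarrow> 0 \<le> s i" "(\<Sum>i\<in>I. s i) = 1" "\<And>k. y k = (\<Sum>i\<in>I. s i * u i k)"
    and ya: "y a \<ge> 1 / real (card I) ^ 2"
  obtains u' s' l where
    "\<And>i. i \<in> I \<Longrightarrow> Q (l i) (u' i)" "\<And>i. i \<in> I \<Longrightarrow> l i \<le> 6 * card I ^ 9" "\<And>i. i \<in> I \<Longrightarrow> 0 \<le> u' i a"
    "generates I u' A" "\<And>i. i \<in> I \<Longrightarrow> 0 \<le> s' i" "\<And>k. y k = (\<Sum>i\<in>I. s' i * u' i k)"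
proof -
  define d where "d = card I"
  have d1: "d \<ge> 1" using fin unfolding d_def by (simp add: Suc_le_eq card_gt_0_iff)
  then have D1: "real d \<ge> 1" by simp
  have "mediant_state Q a I A y (u, s, \<lambda>_. 1)"
    using u s d1 by (simp add: mediant_state_def d_def)
  from mediant_descent[OF fin add this ya]
  obtain v r l j where st: "mediant_state Q a I A y (v, r, l)"
    and j: "j \<in> I" "v j a \<ge> 1 / real d ^ 3" "r j \<ge> 1 / real d ^ 4" "l j \<le> d ^ 4"
    and bad: "\<And>i. i \<in> I \<Longrightarrow> v i a < 0 \<Longrightarrow> r i < 1 / (2 * real d ^ 9)"
    unfolding d_def by blast
  note st' = st[unfolded mediant_state_def prod.case, folded d_def]
  define B where "B = {i \<in> I. v i a < 0}"
  have vj: "v j a > 0" using j D1 by (smt (verit) divide_pos_pos zero_less_power)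
  have finB: "finite B" using fin by (auto simp: B_def)
  \<comment> \<open>The negative generators are corrected one at a time. Each correction lowers the
    coefficient of \<open>v j\<close> by at most \<open>1 / d ^ 5\<close>, and there are at most
    \<open>d\<close> of them, so \<open>r j \<ge> 1 / d ^ 4\<close> can pay for all.\<close>
  have "\<exists>u' s' l'. (\<forall>i\<in>I. Q (l' i) (u' i)) \<and> (\<forall>i\<in>I. i \<notin> C \<longrightarrow> u' i = v i \<and> l' i = l i) \<and>
      (\<forall>i\<in>C. 0 \<le> u' i a \<and> l' i \<le> 6 * d ^ 9) \<and> generates I u' A \<and>
      (\<forall>i\<in>I. i \<noteq> j \<longrightarrow> s' i = r i) \<and> s' j \<ge> r j - card C / real d ^ 5 \<and>
      (\<forall>k. y k = (\<Sum>i\<in>I. s' i * u' i k))" if "C \<subseteq> B" for C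
    using finite_subset[OF that finB] that
  proof (induction C rule: finite_induct)
    case empty
    show ?case by (intro exI[of _ v] exI[of _ r] exI[of _ l]) (use st' in auto)
  next
    case (insert i C)
    then obtain u' s' l' where IH: "\<forall>i\<in>I. Q (l' i) (u' i)" "\<forall>i\<in>I. i \<notin> C \<longrightarrow> u' i = v i \<and> l' i = l i"
      "\<forall>i\<in>C. 0 \<le> u' i a \<and> l' i \<le> 6 * d ^ 9" "generates I u' A"
      "\<forall>i\<in>I. i \<noteq> j \<longrightarrow> s' i = r i" "s' j \<ge> r j - card C / real d ^ 5"
      "\<forall>k. y k = (\<Sum>i\<in>I. s' i * u' i k)" by auto
    have i: "i \<in> I" "v i a < 0" "i \<notin> C" using insert by (auto simp: B_def)
    have ij: "i \<noteq> j" "j \<notin> C" using i vj insert by (auto simp: B_def)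
    have ui: "u' i = v i" "l' i = l i" "u' j = v j" "l' j = l j" "s' i = r i"
      using IH i ij j by auto
    \<comment> \<open>The least number of copies of \<open>v j\<close> that makes the
      \<open>a\<close>-coordinate nonnegative. It is at most \<open>d / (1 / d ^ 3) = d ^ 4\<close>,
      and the factor \<open>r i < 1 / (2 * d ^ 9)\<close> keeps the cost \<open>m * r i\<close>
      below \<open>1 / d ^ 5\<close>.\<close>
    define m where "m = nat \<lceil>- v i a / v j a\<rceil>"
    have "- v i a / v j a \<le> real d / (1 / real d ^ 3)"
    proof (rule frac_le)
      have "\<bar>v i a\<bar> \<le> d" using st' i by blast
      then show "- v i a \<le> d" by simp
    qed (use j D1 in auto)
    also have "\<dots> = real (d ^ 4)" by (simp add: power4_eq_xxxx power3_eq_cube)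
    finally have "\<lceil>- v i a / v j a\<rceil> \<le> int (d ^ 4)" by (simp only: ceiling_le_iff of_int_of_nat_eq)
    then have m: "m \<le> d ^ 4" unfolding m_def by (metis nat_le_iff)
    have "- v i a / v j a \<le> m" unfolding m_def by (rule of_nat_ceiling)
    then have pos: "0 \<le> v i a + m * v j a" using vj by (simp add: field_simps)
    have ri: "0 \<le> r i" "r i \<le> 1 / (2 * real d ^ 9)" using st' bad[of i] i by auto
    have "m * r i \<le> real (d ^ 4) * (1 / (2 * real d ^ 9))"
      using m ri by (intro mult_mono) auto
    also have "\<dots> = 1 / (2 * real d ^ 5)"
      using D1 by (simp add: field_simps flip: power_add)
    also have "\<dots> \<le> 1 / real d ^ 5" using D1 by (simp add: field_simps)
    finally have mr: "m * r i \<le> 1 / real d ^ 5" .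
    define u'' where "u'' = u'(i := (\<lambda>k. u' i k + of_int (int m) * u' j k))"
    define s'' where "s'' = s'(j := s' j - real m * s' i)"
    define l'' where "l'' = l'(i := l' i + m * l' j)"
    have "generates I u'' A" unfolding u''_def
      by (rule generates_elementary) (use IH fin i j ij in auto)
    moreover have "\<forall>k. y k = (\<Sum>i\<in>I. s'' i * u'' i k)"
      using sum_elementary[OF fin(1) i(1) j(1) ij(1), of s' m u'] IH by (simp add: u''_def s''_def)
    moreover have "Q (l' i + m * l' j) (\<lambda>k. u' i k + real m * u' j k)"
      by (rule closed_multiple[of Q]) (use add IH(1) i j in blast)+
    then have "\<forall>i\<in>I. Q (l'' i) (u'' i)"
      using IH(1) by (simp add: u''_def l''_def)
    moreover have "\<forall>t\<in>I. t \<notin> insert i C \<longrightarrow> u'' t = v t \<and> l'' t = l t"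
      using IH by (auto simp: u''_def l''_def)
    moreover have "l i + m * l j \<le> 6 * d ^ 9"
    proof -
      have "m * l j \<le> d ^ 4 * d ^ 4" using m j by (intro mult_mono) auto
      also have "\<dots> \<le> d ^ 9" using d1 by (simp flip: power_add add: power_increasing)
      finally have "m * l j \<le> d ^ 9" .
      moreover have "l i \<le> 4 * d ^ 9" using st' i by auto
      ultimately show ?thesis by linarith
    qed
    then have "\<forall>t\<in>insert i C. 0 \<le> u'' t a \<and> l'' t \<le> 6 * d ^ 9"
      using IH pos ui by (auto simp: u''_def l''_def)
    moreover have "\<forall>t\<in>I. t \<noteq> j \<longrightarrow> s'' t = r t" using IH by (auto simp: s''_def)
    moreover have "s'' j \<ge> r j - card (insert i C) / real d ^ 5"
      using IH(6) mr insert(1) i ui by (simp add: s''_def add_divide_distrib)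
    ultimately show ?case by blast
  qed
  from this[OF order_refl] obtain u' s' l' where F: "\<forall>i\<in>I. Q (l' i) (u' i)"
      "\<forall>i\<in>I. i \<notin> B \<longrightarrow> u' i = v i \<and> l' i = l i"
      "\<forall>i\<in>B. 0 \<le> u' i a \<and> l' i \<le> 6 * d ^ 9" "generates I u' A"
      "\<forall>i\<in>I. i \<noteq> j \<longrightarrow> s' i = r i" "s' j \<ge> r j - card B / real d ^ 5"
      "\<forall>k. y k = (\<Sum>i\<in>I. s' i * u' i k)" by auto
  have "card B \<le> d" unfolding d_def B_def by (rule card_mono) (use fin in auto)
  then have "card B / real d ^ 5 \<le> real d / real d ^ 5" by (intro divide_right_mono) auto
  also have "\<dots> = 1 / real d ^ 4" using D1 by (simp add: eval_nat_numeral)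
  finally have "s' j \<ge> 0" using F(6) j by linarith
  then have s0: "0 \<le> s' i" if "i \<in> I" for i using F(5) st' that by (cases "i = j") auto
  show ?thesis
  proof (rule that[of l' u' s'])
    fix i assume i: "i \<in> I"
    show "Q (l' i) (u' i)" using F i by auto
    have "l i \<le> 4 * d ^ 9" using st' i by auto
    then have "l i \<le> 6 * d ^ 9" by linarith
    then show "l' i \<le> 6 * card I ^ 9" using F i unfolding d_def by (cases "i \<in> B") auto
    show "0 \<le> u' i a" using F i by (cases "i \<in> B") (auto simp: B_def)
    show "0 \<le> s' i" using s0 i .
  qed (use F in auto)
qed

section \<open>Lattices containing the standard lattice of an orthant\<close>

text \<open>Discreteness is expressed by finiteness in boxes. For finite \<open>I\<close> these are
  the lattices in the real space over \<open>I\<close> that contain the standard lattice.\<close>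

definition lattice_on :: "'i set \<Rightarrow> ('i \<Rightarrow> real) set \<Rightarrow> bool" where
  "lattice_on I A \<longleftrightarrow> (\<forall>z\<in>A. \<forall>k. k \<notin> I \<longrightarrow> z k = 0) \<and>
     (\<forall>x\<in>A. \<forall>y\<in>A. (\<lambda>k. x k - y k) \<in> A) \<and> (\<forall>i\<in>I. unit i \<in> A) \<and>
     (\<forall>R. finite {z \<in> A. \<forall>k\<in>I. \<bar>z k\<bar> \<le> R})"

text \<open>The notion concerns a single point \<open>y\<close>, and the unimodular cone may depend
  on it. Thus no triangulation or fan is ever constructed.\<close>

definition cone_covered :: "'i set \<Rightarrow> ('i \<Rightarrow> real) set \<Rightarrow> real \<Rightarrow> ('i \<Rightarrow> real) \<Rightarrow> bool" where
  "cone_covered I A w y \<longleftrightarrow> (\<exists>(u :: 'i \<Rightarrow> 'i \<Rightarrow> real) s.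
     (\<forall>i\<in>I. u i \<in> A \<and> (\<forall>k. 0 \<le> u i k) \<and> (\<Sum>k\<in>I. u i k) \<le> w \<and> 0 \<le> s i) \<and>
     generates I u A \<and> (\<forall>k. y k = (\<Sum>i\<in>I. s i * u i k)))"

text \<open>The number of these points is the termination measure for star subdivision. The weight
  bound is not strict, so that the vectors \<open>unit i\<close> are counted; it is one of them that
  a subdivision removes.\<close>

definition light_points :: "'i set \<Rightarrow> ('i \<Rightarrow> real) set \<Rightarrow> ('i \<Rightarrow> real) set" where
  "light_points I A = {z \<in> A. (\<forall>k\<in>I. 0 \<le> z k) \<and> (\<Sum>k\<in>I. z k) \<le> 1}"

section \<open>Lattice arithmetic and star subdivision\<close>

lemma lattice_onD:
  assumes "lattice_on I A"
  shows lattice_supp: "z \<in> A \<Longrightarrow> k \<notin> I \<Longrightarrow> z k = 0"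
    and lattice_diff: "x \<in> A \<Longrightarrow> y \<in> A \<Longrightarrow> (\<lambda>k. x k - y k) \<in> A"
    and lattice_unit: "i \<in> I \<Longrightarrow> unit i \<in> A"
    and lattice_finite: "finite {z \<in> A. \<forall>k\<in>I. \<bar>z k\<bar> \<le> R}"
  using assms unfolding lattice_on_def by blast+

lemma lattice_add:
  assumes "lattice_on I A" "x \<in> A" "y \<in> A"
  shows "(\<lambda>k. x k + y k) \<in> A"
proof -
  have "(\<lambda>k. y k - y k) \<in> A" by (rule lattice_diff[OF assms(1,3,3)])
  from lattice_diff[OF assms(1) this assms(3)] have "(\<lambda>k. - y k) \<in> A" by simp
  from lattice_diff[OF assms(1,2) this] show ?thesis by simp
qed

lemma lattice_add_of_int:
  assumes "lattice_on I A" "x \<in> A" "y \<in> A"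
  shows "(\<lambda>k. x k + of_int m * y k) \<in> A"
proof (induction m rule: int_induct[of _ 0])
  case base
  then show ?case using assms by simp
next
  case (step1 i)
  from lattice_add[OF assms(1) step1(2) assms(3)] show ?case by (simp add: algebra_simps)
next
  case (step2 i)
  from lattice_diff[OF assms(1) step2(2) assms(3)] show ?case by (simp add: algebra_simps)
qed

lemma lattice_add_sum:
  assumes "lattice_on I A" "x \<in> A" "finite J" "\<And>j. j \<in> J \<Longrightarrow> u j \<in> A"
  shows "(\<lambda>k. x k + (\<Sum>j\<in>J. of_int (c j) * u j k)) \<in> A"
  using assms(3,4)
proof (induction J rule: finite_induct)
  case empty
  then show ?case using assms by simp
next
  case (insert j J)
  from lattice_add_of_int[OF assms(1) insert.IH insert.prems, of j "c j"] insert
  show ?case by (simp add: algebra_simps)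
qed

lemma finite_light_points:
  assumes "finite I" "lattice_on I A"
  shows "finite (light_points I A)"
proof (rule finite_subset[OF _ lattice_finite[OF assms(2), of 1]])
  have "z k \<le> 1" if "\<forall>k\<in>I. 0 \<le> z k" "(\<Sum>k\<in>I. z k) \<le> 1" "k \<in> I" for z :: "'a \<Rightarrow> real" and k
    using member_le_sum[of k I z] that assms by force
  then show "light_points I A \<subseteq> {z \<in> A. \<forall>k\<in>I. \<bar>z k\<bar> \<le> 1}"
    unfolding light_points_def by auto
qed

text \<open>With the light vector \<open>x\<close> in place of \<open>unit i\<close> as a generator of the orthant the coordinates change
  by \<open>\<psi>\<close>, and \<open>unit i\<close> is no longer a light point.\<close>
lemma cone_covered_star:
  fixes A :: "('i \<Rightarrow> real) set"
  assumes fin: "finite I" and lat: "lattice_on I A"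
    and x: "x \<in> A" "\<And>k. 0 \<le> x k" "x i > 0" "i \<in> I" "(\<Sum>k\<in>I. x k) < 1"
    and y: "\<And>k. 0 \<le> y k" "\<And>k. k \<notin> I \<Longrightarrow> y k = 0"
      "\<And>k. k \<in> I \<Longrightarrow> x k > 0 \<Longrightarrow> y i / x i \<le> y k / x k"
    and IH: "\<And>A' y'. lattice_on I A' \<Longrightarrow> card (light_points I A') < card (light_points I A) \<Longrightarrow>
      (\<And>k. 0 \<le> y' k) \<Longrightarrow> (\<And>k. k \<notin> I \<Longrightarrow> y' k = 0) \<Longrightarrow> cone_covered I A' w y'"
  shows "cone_covered I A w y"
proof -
  \<comment> \<open>The linear map that sends \<open>unit i\<close> to \<open>x\<close> and fixes
    the other unit vectors; \<open>\<phi>\<close> is its inverse, and \<open>A'\<close> is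
    \<open>A\<close> in the new coordinates.\<close>
  define \<psi> :: "('i \<Rightarrow> real) \<Rightarrow> 'i \<Rightarrow> real" where
    "\<psi> = (\<lambda>z k. (if k = i then 0 else z k) + z i * x k)"
  define \<phi> :: "('i \<Rightarrow> real) \<Rightarrow> 'i \<Rightarrow> real" where
    "\<phi> = (\<lambda>z k. if k = i then z i / x i else z k - z i / x i * x k)"
  define A' where "A' = {z. \<psi> z \<in> A}"
  have \<psi>\<phi>: "\<psi> (\<phi> z) = z" and \<phi>\<psi>: "\<phi> (\<psi> z) = z" for z
    using x(3) by (auto simp: \<psi>_def \<phi>_def fun_eq_iff)
  have inj: "inj \<psi>" by (metis injI \<phi>\<psi>)
  have x1: "x k \<le> 1" for k
  proof (cases "k \<in> I")
    case True
    then show ?thesis using member_le_sum[of k I x] x fin by force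
  qed (use lattice_supp[OF lat x(1)] in auto)
  have xI: "x k = 0" if "k \<notin> I" for k using lattice_supp[OF lat x(1)] that by auto
  \<comment> \<open>As \<open>x\<close> has weight less than 1, \<open>\<psi>\<close> does not
    increase the weight of a vector with \<open>z i \<ge> 0\<close>. So weight bounds carry over
    from \<open>A'\<close> to \<open>A\<close>.\<close>
  have sum\<psi>: "(\<Sum>k\<in>I. \<psi> z k) = (\<Sum>k\<in>I. z k) - z i * (1 - (\<Sum>k\<in>I. x k))" for z
  proof -
    have "(\<Sum>k\<in>I. \<psi> z k) = (\<Sum>k\<in>I. if k = i then 0 else z k) + z i * (\<Sum>k\<in>I. x k)"
      by (simp add: \<psi>_def sum.distrib sum_distrib_left)
    also have "(\<Sum>k\<in>I. if k = i then 0 else z k) = (\<Sum>k\<in>I - {i}. z k)"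
      using fin by (intro sum.mono_neutral_cong_right) auto
    also have "\<dots> = (\<Sum>k\<in>I. z k) - z i" using fin x by (simp add: sum_diff1)
    finally show ?thesis by (simp add: algebra_simps)
  qed
  have lat': "lattice_on I A'"
    unfolding lattice_on_def
  proof (intro conjI ballI allI impI)
    fix z k assume z: "z \<in> A'" and k: "k \<notin> I"
    have "\<psi> z k = 0" using lattice_supp[OF lat _ k] z by (simp add: A'_def)
    then show "z k = 0" using k x(4) xI by (auto simp: \<psi>_def split: if_splits)
  next
    fix v z assume vz: "v \<in> A'" "z \<in> A'"
    have "\<psi> (\<lambda>k. v k - z k) = (\<lambda>k. \<psi> v k - \<psi> z k)" by (auto simp: \<psi>_def algebra_simps)
    then show "(\<lambda>k. v k - z k) \<in> A'" using lattice_diff[OF lat] vz by (simp add: A'_def)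
  next
    fix j assume j: "j \<in> I"
    have "\<psi> (unit j) = (if j = i then x else unit j)" by (auto simp: \<psi>_def unit_def)
    then show "unit j \<in> A'" using x lattice_unit[OF lat j] by (simp add: A'_def)
  next
    fix R
    have "\<psi> ` {z \<in> A'. \<forall>k\<in>I. \<bar>z k\<bar> \<le> R} \<subseteq> {z \<in> A. \<forall>k\<in>I. \<bar>z k\<bar> \<le> R + R}"
    proof
      fix v assume "v \<in> \<psi> ` {z \<in> A'. \<forall>k\<in>I. \<bar>z k\<bar> \<le> R}"
      then obtain z where z: "v = \<psi> z" "z \<in> A'" "\<forall>k\<in>I. \<bar>z k\<bar> \<le> R" by auto
      then have R: "\<bar>z i\<bar> \<le> R" using x by auto
      have "\<bar>\<psi> z k\<bar> \<le> R + R" if k: "k \<in> I" for k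
      proof -
        have "\<bar>z i\<bar> * \<bar>x k\<bar> \<le> R * 1"
          using R x x1[of k] by (intro mult_mono) auto
        then have "\<bar>z i * x k\<bar> \<le> R" by (simp add: abs_mult)
        moreover have "\<bar>if k = i then 0 else z k\<bar> \<le> R" using z k R by auto
        ultimately show ?thesis unfolding \<psi>_def by linarith
      qed
      then show "v \<in> {z \<in> A. \<forall>k\<in>I. \<bar>z k\<bar> \<le> R + R}" using z by (simp add: A'_def)
    qed
    then have "finite (\<psi> ` {z \<in> A'. \<forall>k\<in>I. \<bar>z k\<bar> \<le> R})"
      using lattice_finite[OF lat] finite_subset by blast
    then show "finite {z \<in> A'. \<forall>k\<in>I. \<bar>z k\<bar> \<le> R}"
      by (rule finite_imageD[OF _ inj_on_subset[OF inj subset_UNIV]])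
  qed
  have nonneg\<psi>: "0 \<le> \<psi> z k" if "\<forall>k\<in>I. 0 \<le> z k" "k \<in> I" for z k
    using that x by (auto simp: \<psi>_def)
  have le\<psi>: "(\<Sum>k\<in>I. \<psi> z k) \<le> (\<Sum>k\<in>I. z k)" if "0 \<le> z i" for z
    using that x sum\<psi>[of z] by (simp add: mult_nonneg_nonneg)
  have "\<psi> ` light_points I A' \<subset> light_points I A"
  proof
    show "\<psi> ` light_points I A' \<subseteq> light_points I A"
    proof safe
      fix z assume z: "z \<in> light_points I A'"
      then have "0 \<le> z i" using x by (auto simp: light_points_def)
      from le\<psi>[of z, OF this] nonneg\<psi>[of z] z show "\<psi> z \<in> light_points I A"
        by (auto simp: light_points_def A'_def)
    qed
    have "unit i \<in> light_points I A"
      using fin x lattice_unit[OF lat] by (auto simp: light_points_def unit_def)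
    \<comment> \<open>A preimage would have \<open>i\<close>-th coordinate
      \<open>1 / x i > 1\<close> and hence too large a weight.\<close>
    moreover have "unit i \<notin> \<psi> ` light_points I A'"
    proof
      assume "unit i \<in> \<psi> ` light_points I A'"
      then obtain z where z: "unit i = \<psi> z" "z \<in> light_points I A'" by auto
      have "z i \<le> (\<Sum>k\<in>I. z k)" using z fin x by (intro member_le_sum) (auto simp: light_points_def)
      then have "z i \<le> 1" using z by (simp add: light_points_def)
      moreover have "1 = z i * x i" using fun_cong[OF z(1), of i] by (simp add: \<psi>_def unit_def)
      moreover have "x i < 1" using member_le_sum[of i I x] x fin by force
      ultimately show False using x(3) by (smt (verit) mult_left_le_one_le mult_nonneg_nonneg mult_neg_pos)
    qed
    ultimately show "\<psi> ` light_points I A' \<noteq> light_points I A" by auto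
  qed
  then have "card (\<psi> ` light_points I A') < card (light_points I A)"
    by (rule psubset_card_mono[OF finite_light_points[OF fin lat]])
  then have less: "card (light_points I A') < card (light_points I A)"
    by (simp add: card_image inj_on_subset[OF inj])
  \<comment> \<open>Minimality of the ratio \<open>y i / x i\<close> says that \<open>y\<close> lies
    in the cone spanned by \<open>x\<close> and the remaining unit vectors, i.e. that
    \<open>\<phi> y\<close> is nonnegative.\<close>
  have "cone_covered I A' w (\<phi> y)"
  proof (rule IH[OF lat' less])
    fix k
    show "0 \<le> \<phi> y k"
    proof (cases "k \<in> I \<and> k \<noteq> i \<and> x k > 0")
      case True
      then show ?thesis using y(3)[of k] x by (simp add: \<phi>_def field_simps)
    next
      case False
      then have "k = i \<or> x k = 0" using xI[of k] x(2)[of k] by force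
      then show ?thesis using y(1) x by (auto simp: \<phi>_def)
    qed
  next
    fix k assume "k \<notin> I"
    then show "\<phi> y k = 0" using xI y x by (auto simp: \<phi>_def)
  qed
  then obtain u s where u: "\<forall>i\<in>I. u i \<in> A' \<and> (\<forall>k. 0 \<le> u i k) \<and> (\<Sum>k\<in>I. u i k) \<le> w \<and> 0 \<le> s i"
    "generates I u A'" "\<forall>k. \<phi> y k = (\<Sum>i\<in>I. s i * u i k)"
    unfolding cone_covered_def by blast
  have \<psi>_sum: "\<psi> z k = (\<Sum>i\<in>I. c i * \<psi> (u i) k)" if "\<forall>k. z k = (\<Sum>i\<in>I. c i * u i k)" for z c k
  proof -
    have "(\<Sum>j\<in>I. c j * \<psi> (u j) k)
        = (if k = i then 0 else (\<Sum>j\<in>I. c j * u j k)) + (\<Sum>j\<in>I. c j * u j i) * x k"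
      by (simp add: \<psi>_def distrib_left sum.distrib sum_distrib_right mult.assoc)
    also have "\<dots> = \<psi> z k" using that by (simp add: \<psi>_def)
    finally show ?thesis ..
  qed
  show ?thesis
    unfolding cone_covered_def
  proof (intro exI[of _ "\<lambda>i. \<psi> (u i)"] exI[of _ s] conjI ballI allI)
    fix j assume j: "j \<in> I"
    show "\<psi> (u j) \<in> A" using u j by (simp add: A'_def)
    show "0 \<le> \<psi> (u j) k" for k using u j x by (auto simp: \<psi>_def)
    show "(\<Sum>k\<in>I. \<psi> (u j) k) \<le> w" using u j le\<psi>[of "u j"] by force
    show "0 \<le> s j" using u j by auto
  next
    show "y k = (\<Sum>i\<in>I. s i * \<psi> (u i) k)" for k
      using \<psi>_sum[of "\<phi> y" s k] u by (simp add: \<psi>\<phi>)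
  next
    show "generates I (\<lambda>i. \<psi> (u i)) A"
      unfolding generates_def
    proof
      fix z assume "z \<in> A"
      then have "\<phi> z \<in> A'" by (simp add: A'_def \<psi>\<phi>)
      then obtain c :: "'i \<Rightarrow> int" where "\<forall>k. \<phi> z k = (\<Sum>i\<in>I. of_int (c i) * u i k)"
        using u(2) unfolding generates_def by blast
      from \<psi>_sum[of "\<phi> z" "\<lambda>i. of_int (c i)", OF this]
      show "\<exists>c::'i \<Rightarrow> int. \<forall>k. z k = (\<Sum>i\<in>I. of_int (c i) * \<psi> (u i) k)"
        by (auto simp: \<psi>\<phi>)
    qed
  qed
qed

section \<open>Lifting from the quotient modulo a coordinate axis\<close>

lemma lattice_on_quotient:
  fixes A :: "('i \<Rightarrow> real) set"
  assumes fin: "finite I" and lat: "lattice_on I A" and a: "a \<in> I"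
  shows "lattice_on (I - {a}) ((\<lambda>z. z(a := 0)) ` A)"
  unfolding lattice_on_def
proof (intro conjI ballI allI impI)
  fix z k assume "z \<in> (\<lambda>z. z(a := 0)) ` A" "k \<notin> I - {a}"
  then show "z k = 0" using lattice_supp[OF lat] by auto
next
  fix x y assume "x \<in> (\<lambda>z. z(a := 0)) ` A" "y \<in> (\<lambda>z. z(a := 0)) ` A"
  then obtain x' y' where xy: "x' \<in> A" "y' \<in> A" "x = x'(a := 0)" "y = y'(a := 0)" by auto
  have "(\<lambda>k. x k - y k) = (\<lambda>k. x' k - y' k)(a := 0)" using xy by auto
  then show "(\<lambda>k. x k - y k) \<in> (\<lambda>z. z(a := 0)) ` A"
    using lattice_diff[OF lat xy(1,2)] by blast
next
  fix i assume i: "i \<in> I - {a}"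
  have "unit i = (unit i)(a := 0)" using i by (auto simp: unit_def)
  then show "unit i \<in> (\<lambda>z. z(a := 0)) ` A" using lattice_unit[OF lat, of i] i by blast
next
  fix R
  have "{z \<in> (\<lambda>z. z(a := 0)) ` A. \<forall>k\<in>I - {a}. \<bar>z k\<bar> \<le> R}
      \<subseteq> (\<lambda>z. z(a := 0)) ` {z \<in> A. \<forall>k\<in>I. \<bar>z k\<bar> \<le> max R 1}"
  proof
    fix z assume "z \<in> {z \<in> (\<lambda>z. z(a := 0)) ` A. \<forall>k\<in>I - {a}. \<bar>z k\<bar> \<le> R}"
    then obtain z' where z': "z' \<in> A" "z = z'(a := 0)" "\<forall>k\<in>I - {a}. \<bar>z' k\<bar> \<le> R" by auto
    \<comment> \<open>Discreteness survives the projection because every class has a representative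
      with \<open>a\<close>-coordinate in [0, 1).\<close>
    define v where "v = (\<lambda>k. z' k + of_int (- \<lfloor>z' a\<rfloor>) * unit a k)"
    have "v \<in> A" unfolding v_def by (rule lattice_add_of_int[OF lat z'(1) lattice_unit[OF lat a]])
    moreover have "\<bar>v a\<bar> \<le> 1" by (simp add: v_def unit_def) linarith
    then have "\<forall>k\<in>I. \<bar>v k\<bar> \<le> max R 1" using z' by (auto simp: v_def unit_def le_max_iff_disj)
    moreover have "z = v(a := 0)" using z' by (auto simp: v_def unit_def)
    ultimately show "z \<in> (\<lambda>z. z(a := 0)) ` {z \<in> A. \<forall>k\<in>I. \<bar>z k\<bar> \<le> max R 1}" by blast
  qed
  then show "finite {z \<in> (\<lambda>z. z(a := 0)) ` A. \<forall>k\<in>I - {a}. \<bar>z k\<bar> \<le> R}"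
    using lattice_finite[OF lat] finite_subset by blast
qed

text \<open>The new generators are sums of at most \<open>6 * d ^ 9\<close> of the initial ones,
  where \<open>d = card I\<close>. Each initial generator adds at most \<open>d + w\<close> to the
  weight off the axis and at most \<open>d\<close> to the \<open>a\<close>-coordinate; this gives
  the bound.\<close>

lemma cone_covered_empty:
  fixes A :: "('i \<Rightarrow> real) set"
  assumes fin: "finite I" and lat: "lattice_on I A" and a: "a \<in> I"
    and empty: "\<And>z. z \<in> A \<Longrightarrow> \<forall>k\<in>I. 0 \<le> z k \<Longrightarrow> \<exists>k\<in>I. z k \<noteq> 0 \<Longrightarrow> 1 \<le> (\<Sum>k\<in>I. z k)"
    and y: "\<And>k. 0 \<le> y k" "\<And>k. k \<notin> I \<Longrightarrow> y k = 0" "\<And>k. k \<in> I \<Longrightarrow> y k \<le> y a" "0 < y a"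
    and IH: "cone_covered (I - {a}) ((\<lambda>z. z(a := 0)) ` A) w (y(a := 0))"
    and w: "0 \<le> w"
  shows "cone_covered I A (6 * real (card I) ^ 9 * (w + 2 * real (card I))) y"
proof -
  define d where "d = card I"
  define J where "J = I - {a}"
  have J: "finite J" "a \<notin> J" "I = insert a J" using fin a by (auto simp: J_def)
  have Jne: "k \<noteq> a" if "k \<in> J" for k using that J by auto
  have dJ: "d = Suc (card J)" using J by (simp add: d_def)
  have e: "unit a \<in> A" by (rule lattice_unit[OF lat a])
  from IH obtain xb c where xb: "\<forall>i\<in>J. xb i \<in> (\<lambda>z. z(a := 0)) ` A \<and> (\<forall>k. 0 \<le> xb i k) \<and>
      (\<Sum>k\<in>J. xb i k) \<le> w \<and> 0 \<le> c i" "generates J xb ((\<lambda>z. z(a := 0)) ` A)"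
      "\<forall>k. (y(a := 0)) k = (\<Sum>i\<in>J. c i * xb i k)"
    unfolding cone_covered_def J_def by auto
  have "\<exists>X. X \<in> A \<and> xb i = X(a := 0) \<and> -1 < X a \<and> X a \<le> 0" if i: "i \<in> J" for i
  proof -
    from xb(1) i obtain z where z: "z \<in> A" "xb i = z(a := 0)" by blast
    have "(\<lambda>k. z k + of_int (- \<lceil>z a\<rceil>) * unit a k) \<in> A" (is "?X \<in> A")
      by (rule lattice_add_of_int[OF lat z(1) e])
    moreover have "xb i = ?X(a := 0)" using z by (auto simp: unit_def)
    moreover have "-1 < ?X a \<and> ?X a \<le> 0" by (simp add: unit_def) linarith
    ultimately show ?thesis by blast
  qed
  then obtain X where X: "\<And>i. i \<in> J \<Longrightarrow> X i \<in> A" "\<And>i. i \<in> J \<Longrightarrow> xb i = (X i)(a := 0)"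
    "\<And>i. i \<in> J \<Longrightarrow> -1 < X i a" "\<And>i. i \<in> J \<Longrightarrow> X i a \<le> 0" by metis
  have Xb: "X i k = xb i k" if "i \<in> J" "k \<noteq> a" for i k using X(2)[OF that(1)] that by simp
  have X0: "0 \<le> X i k" if "i \<in> J" "k \<noteq> a" for i k using Xb[OF that] xb(1) that by simp
  have Xw: "(\<Sum>k\<in>J. X i k) \<le> w" if "i \<in> J" for i
  proof -
    have "(\<Sum>k\<in>J. X i k) = (\<Sum>k\<in>J. xb i k)" using Jne Xb that by (intro sum.cong refl) metis
    then show ?thesis using xb(1) that by simp
  qed
  have c0: "0 \<le> c i" if "i \<in> J" for i using xb(1) that by blast
  have yk: "y k = (\<Sum>i\<in>J. c i * X i k)" if "k \<noteq> a" for k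
  proof -
    have "y k = (y(a := 0)) k" using that by simp
    also have "\<dots> = (\<Sum>i\<in>J. c i * xb i k)" using xb(3) by blast
    also have "\<dots> = (\<Sum>i\<in>J. c i * X i k)" using Xb that by simp
    finally show ?thesis .
  qed
  have sumI: "(\<Sum>k\<in>I. z k) = z a + (\<Sum>k\<in>J. z k)" for z :: "'i \<Rightarrow> real" using J by simp
  txt \<open>Adding \<open>unit a\<close> brings \<open>X i\<close> into the orthant, where by emptiness its weight is at least 1.\<close>
  have tau: "- X i a \<le> (\<Sum>k\<in>J. X i k)" if i: "i \<in> J" for i
  proof -
    define z where "z = (\<lambda>k. X i k + of_int 1 * unit a k)"
    have z: "z \<in> A" unfolding z_def by (rule lattice_add_of_int[OF lat X(1)[OF i] e])
    have za: "z a = X i a + 1" "\<And>k. k \<noteq> a \<Longrightarrow> z k = X i k" by (auto simp: z_def unit_def)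
    have "1 \<le> (\<Sum>k\<in>I. z k)"
    proof (rule empty[OF z])
      show "\<forall>k\<in>I. 0 \<le> z k"
      proof
        fix k
        show "0 \<le> z k" using za X(3)[OF i] X0[OF i, of k] by (cases "k = a") auto
      qed
      show "\<exists>k\<in>I. z k \<noteq> 0" using za X(3)[OF i] a by (intro bexI[of _ a]) auto
    qed
    also have "\<dots> = X i a + 1 + (\<Sum>k\<in>J. X i k)"
      unfolding sumI za(1) using Jne za(2) by (intro arg_cong2[of _ _ _ _ "(+)"] sum.cong) auto
    finally show ?thesis by simp
  qed
  define Y where "Y = (\<Sum>k\<in>J. y k)"
  have Y_alt: "Y = (\<Sum>i\<in>J. c i * (\<Sum>k\<in>J. X i k))"
  proof -
    have "Y = (\<Sum>k\<in>J. \<Sum>i\<in>J. c i * X i k)" unfolding Y_def using Jne yk by (intro sum.cong refl) metis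
    also have "\<dots> = (\<Sum>i\<in>J. \<Sum>k\<in>J. c i * X i k)" by (rule sum.swap)
    finally show ?thesis by (simp add: sum_distrib_left)
  qed
  have "Y \<le> card J * y a" unfolding Y_def by (rule sum_bounded_above) (use y J in auto)
  then have Yd: "Y \<le> (real d - 1) * y a" by (simp add: dJ)
  \<comment> \<open>The coefficient of \<open>unit a\<close> when \<open>y\<close> is written in
    terms of \<open>unit a\<close> and the lifts \<open>X i\<close>. By \<open>tau\<close> and the
    maximality of \<open>y a\<close> it lies between \<open>y a\<close> and
    \<open>d * y a\<close>.\<close>
  define c0 where "c0 = y a + (\<Sum>i\<in>J. c i * (- X i a))"
  have "(\<Sum>i\<in>J. c i * (- X i a)) \<le> Y" unfolding Y_alt
    by (intro sum_mono mult_left_mono tau c0)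
  then have c0d: "c0 \<le> d * y a" using Yd unfolding c0_def by (simp add: algebra_simps)
  have "0 \<le> (\<Sum>i\<in>J. c i * (- X i a))"
    by (intro sum_nonneg mult_nonneg_nonneg c0) (use X in auto)
  then have c0y: "y a \<le> c0" by (simp add: c0_def)
  then have c0pos: "0 < c0" using y by linarith
  define n where "n = (\<lambda>i. \<lfloor>c i / c0\<rfloor>)"
  define r where "r = (\<lambda>i. frac (c i / c0))"
  have cn: "c i / c0 = of_int (n i) + r i" for i by (simp add: n_def r_def frac_def)
  have n0: "0 \<le> n i" if "i \<in> J" for i using c0[OF that] c0pos by (simp add: n_def)
  have r0: "0 \<le> r i" "r i \<le> 1" for i by (auto simp: r_def frac_ge_0 less_imp_le[OF frac_lt_1])
  have nle: "of_int (n i) \<le> c i / c0" for i by (simp add: n_def)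
  \<comment> \<open>The integral part of \<open>y / c0\<close> with respect to \<open>unit a\<close>
    and the \<open>X i\<close>. The rest has coefficients in [0, 1), so \<open>y\<close> lies in the
    cone of \<open>p\<close> and the \<open>X i\<close>, and \<open>p\<close> may replace
    \<open>unit a\<close> in a basis because it contains \<open>unit a\<close> exactly once.\<close>
  define p where "p = (\<lambda>k. unit a k + (\<Sum>i\<in>J. of_int (n i) * X i k))"
  have pA: "p \<in> A" unfolding p_def by (rule lattice_add_sum[OF lat e J(1) X(1)])
  have yp: "y k / c0 = p k + (\<Sum>i\<in>J. r i * X i k)" for k
  proof -
    have "p k + (\<Sum>i\<in>J. r i * X i k) = unit a k + (\<Sum>i\<in>J. c i / c0 * X i k)"
      by (simp add: p_def cn distrib_right sum.distrib)
    also have "(\<Sum>i\<in>J. c i / c0 * X i k) = (\<Sum>i\<in>J. c i * X i k) / c0"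
      by (simp add: sum_divide_distrib)
    also have "unit a k + (\<Sum>i\<in>J. c i * X i k) / c0 = y k / c0"
    proof (cases "k = a")
      case True
      have "(\<Sum>i\<in>J. c i * X i a) = y a - c0" by (simp add: c0_def sum_negf)
      then show ?thesis using True c0pos by (simp add: unit_def field_simps)
    qed (simp add: unit_def yk)
    finally show ?thesis ..
  qed
  define u where "u = (\<lambda>i. if i = a then p else X i)"
  have u_simps: "u a = p" "\<And>i. i \<in> J \<Longrightarrow> u i = X i" using J by (auto simp: u_def)
  have sumJ_u: "(\<Sum>i\<in>J. g i * u i k) = (\<Sum>i\<in>J. g i * X i k)" for g :: "'i \<Rightarrow> real" and k
    by (rule sum.cong) (auto simp: u_simps)
  \<comment> \<open>The factor that normalises the coefficients of \<open>y / c0\<close> to sum 1.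
    Below, \<open>\<kappa> = c0 * L \<le> d ^ 2 * y a\<close>, so that \<open>y / \<kappa>\<close>
    has \<open>a\<close>-coordinate at least \<open>1 / d ^ 2\<close>, as the mediant argument
    requires.\<close>
  define L where "L = 1 + (\<Sum>i\<in>J. r i)"
  have "(\<Sum>i\<in>J. r i) \<le> real (card J) * 1" by (rule sum_bounded_above) (use r0 in auto)
  moreover have "0 \<le> (\<Sum>i\<in>J. r i)" by (intro sum_nonneg r0)
  ultimately have L: "1 \<le> L" "L \<le> d" by (auto simp: L_def dJ)
  define s where "s = (\<lambda>i. (if i = a then 1 else r i) / L)"
  have sumI_s: "(\<Sum>i\<in>I. s i * g i) = (g a + (\<Sum>i\<in>J. r i * g i)) / L" for g
  proof -
    have "(\<Sum>i\<in>J. s i * g i) = (\<Sum>i\<in>J. r i * g i) / L"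
      unfolding sum_divide_distrib using J by (intro sum.cong) (auto simp: s_def)
    then show ?thesis unfolding sumI by (simp add: s_def add_divide_distrib)
  qed
  define \<kappa> where "\<kappa> = c0 * L"
  have \<kappa>: "0 < \<kappa>" using c0pos L by (simp add: \<kappa>_def)
  define M where "M = real d + w"
  \<comment> \<open>All conditions are additive in \<open>l\<close>, so they pass to sums of
    generators. Nonnegativity is asked off the axis only; the mediants supply it for coordinate
    \<open>a\<close>.\<close>
  define Q where "Q = (\<lambda>(l::nat) v. v \<in> A \<and> (\<forall>k. k \<noteq> a \<longrightarrow> 0 \<le> v k) \<and>
     (\<Sum>k\<in>J. v k) \<le> M * l \<and> v a \<le> d * real l)"
  have gen: "generates I u A"
    unfolding generates_def
  proof
    fix z assume z: "z \<in> A"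
    then obtain g :: "'i \<Rightarrow> int" where g: "\<forall>k. (z(a := 0)) k = (\<Sum>i\<in>J. of_int (g i) * xb i k)"
      using xb(2) unfolding generates_def by blast
    have gX: "z k = (\<Sum>i\<in>J. of_int (g i) * X i k)" if "k \<noteq> a" for k
      using g[rule_format, of k] Xb that by simp
    define t where "t = z a - (\<Sum>i\<in>J. of_int (g i) * X i a)"
    define v where "v = (\<lambda>k. (z k + (\<Sum>i\<in>J. of_int (- g i) * X i k)) + of_int (- \<lfloor>t\<rfloor>) * unit a k)"
    have vA: "v \<in> A" unfolding v_def
      by (intro lattice_add_of_int[OF lat] lattice_add_sum[OF lat z J(1)] X(1) e)
    have va: "v a = frac t" by (simp add: v_def t_def frac_def unit_def sum_negf)
    have v0: "v k = 0" if "k \<noteq> a" for k using that gX by (simp add: v_def unit_def sum_negf)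
    \<comment> \<open>A fractional multiple of \<open>unit a\<close> in the lattice would be a
      nonzero point of weight less than 1, against emptiness. Hence \<open>unit a\<close> and the
      \<open>X i\<close> generate \<open>A\<close>.\<close>
    have "frac t = 0"
    proof (rule ccontr)
      assume "frac t \<noteq> 0"
      then have "1 \<le> (\<Sum>k\<in>I. v k)"
        by (intro empty[OF vA]) (use va v0 a frac_ge_0[of t] in \<open>metis order_refl\<close>)+
      also have "\<dots> = frac t" unfolding sumI va using v0 Jne by (simp add: sum.neutral)
      finally show False using frac_lt_1[of t] by simp
    qed
    then have t: "t = of_int \<lfloor>t\<rfloor>" by (simp add: frac_def)
    define h where "h = (\<lambda>i. if i = a then \<lfloor>t\<rfloor> else g i - \<lfloor>t\<rfloor> * n i)"
    have "z k = (\<Sum>i\<in>I. of_int (h i) * u i k)" for k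
    proof -
      have "(\<Sum>i\<in>J. of_int (h i) * u i k) = (\<Sum>i\<in>J. of_int (g i) * X i k - t * (of_int (n i) * X i k))"
        using J t by (intro sum.cong) (auto simp: h_def u_simps algebra_simps)
      also have "\<dots> = (\<Sum>i\<in>J. of_int (g i) * X i k) - t * (\<Sum>i\<in>J. of_int (n i) * X i k)"
        by (simp add: sum_subtractf sum_distrib_left)
      finally have "(\<Sum>i\<in>I. of_int (h i) * u i k) = t * unit a k + (\<Sum>i\<in>J. of_int (g i) * X i k)"
        unfolding sumI using t by (simp add: h_def u_simps p_def algebra_simps)
      then show ?thesis using gX[of k] by (cases "k = a") (simp_all add: unit_def t_def)
    qed
    then show "\<exists>c::'i \<Rightarrow> int. \<forall>k. z k = (\<Sum>i\<in>I. of_int (c i) * u i k)" by blast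
  qed
  have pa: "0 \<le> p a" "p a \<le> d"
  proof -
    have "p a = y a / c0 + (\<Sum>i\<in>J. r i * (- X i a))" using yp[of a] by (simp add: sum_negf)
    moreover have "0 \<le> (\<Sum>i\<in>J. r i * (- X i a))"
      by (intro sum_nonneg mult_nonneg_nonneg r0) (use X in auto)
    moreover have "(\<Sum>i\<in>J. r i * (- X i a)) \<le> real (card J) * 1"
    proof (rule sum_bounded_above)
      fix i assume "i \<in> J"
      then show "r i * (- X i a) \<le> 1" using mult_mono[of "r i" 1 "- X i a" 1] r0[of i] X(3,4)[of i] by simp
    qed
    moreover have "0 \<le> y a / c0" "y a / c0 \<le> 1" using y c0y c0pos by auto
    ultimately show "0 \<le> p a" "p a \<le> d" by (auto simp: dJ)
  qed
  \<comment> \<open>The multiplicities \<open>n i\<close> are at most \<open>c i / c0\<close>, so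
    the weight of \<open>p\<close> off the axis is at most \<open>Y / c0\<close>.\<close>
  have pJ: "(\<Sum>k\<in>J. p k) \<le> d"
  proof -
    have "(\<Sum>k\<in>J. p k) = (\<Sum>k\<in>J. \<Sum>i\<in>J. of_int (n i) * X i k)"
      using Jne by (intro sum.cong refl) (simp add: p_def unit_def)
    also have "\<dots> = (\<Sum>i\<in>J. of_int (n i) * (\<Sum>k\<in>J. X i k))"
      by (subst sum.swap) (simp add: sum_distrib_left)
    also have "\<dots> \<le> (\<Sum>i\<in>J. c i / c0 * (\<Sum>k\<in>J. X i k))"
      by (intro sum_mono mult_right_mono nle sum_nonneg X0 Jne)
    also have "\<dots> = Y / c0" by (simp add: Y_alt sum_divide_distrib)
    also have "\<dots> \<le> d"
    proof -
      have "Y \<le> (real d - 1) * c0" using Yd mult_left_mono[OF c0y, of "real d - 1"] dJ by simp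
      also have "\<dots> \<le> d * c0" using c0pos by simp
      finally show ?thesis using c0pos by (simp add: field_simps)
    qed
    finally show ?thesis .
  qed
  have Xle: "X i a \<le> d" "\<bar>X i a\<bar> \<le> d" if "i \<in> J" for i using X(3,4)[OF that] dJ by auto
  obtain u' s' l where res: "\<And>i. i \<in> I \<Longrightarrow> Q (l i) (u' i)" "\<And>i. i \<in> I \<Longrightarrow> l i \<le> 6 * card I ^ 9"
    "\<And>i. i \<in> I \<Longrightarrow> 0 \<le> u' i a"
    "generates I u' A" "\<And>i. i \<in> I \<Longrightarrow> 0 \<le> s' i" "\<And>k. y k / \<kappa> = (\<Sum>i\<in>I. s' i * u' i k)"
  proof (rule mediant_refinement[of I Q u a A s "\<lambda>k. y k / \<kappa>"])
    show "finite I" "I \<noteq> {}" using fin a by auto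
    show "Q (l + l') (\<lambda>k. v k + v' k)" if "Q l v" "Q l' v'" for l l' v v'
      using that lattice_add[OF lat, of v v'] by (auto simp: Q_def sum.distrib algebra_simps)
    show "generates I u A" by (rule gen)
    show "0 \<le> s i" for i using r0 L by (simp add: s_def)
    show "(\<Sum>i\<in>I. s i) = 1" using sumI_s[of "\<lambda>_. 1"] L by (simp add: L_def)
    show "y k / \<kappa> = (\<Sum>i\<in>I. s i * u i k)" for k
      using yp[of k] by (simp add: sumI_s u_simps sumJ_u \<kappa>_def flip: divide_divide_eq_left)
    show "1 / real (card I) ^ 2 \<le> y a / \<kappa>"
    proof -
      have "\<kappa> \<le> (d * y a) * d" unfolding \<kappa>_def using c0d L c0pos by (intro mult_mono) auto
      moreover have "0 < real d" by (simp add: dJ)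
      ultimately show ?thesis using \<kappa> unfolding d_def[symmetric]
        by (simp add: field_simps power2_eq_square)
    qed
  next
    fix i assume i: "i \<in> I"
    show "\<bar>u i a\<bar> \<le> real (card I)" unfolding d_def[symmetric]
      using i J pa Xle by (cases "i = a") (auto simp: u_simps)
    show "Q 1 (u i)"
    proof (cases "i = a")
      case True
      have "0 \<le> p k" if "k \<noteq> a" for k using that X0 n0 by (auto simp: p_def unit_def intro!: sum_nonneg)
      then show ?thesis using True pA pJ pa w by (auto simp: Q_def u_simps M_def)
    next
      case False
      then have "i \<in> J" using i J by auto
      then show ?thesis using X(1) X0 Xw[of i] Xle by (auto simp: Q_def u_simps M_def add_increasing)
    qed
  qed (use that in auto)
  show ?thesis
    unfolding cone_covered_def
  proof (intro exI[of _ u'] exI[of _ "\<lambda>i. \<kappa> * s' i"] conjI ballI allI)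
    fix i assume i: "i \<in> I"
    note Qi = res(1)[OF i, unfolded Q_def]
    show "u' i \<in> A" using Qi by blast
    show "0 \<le> u' i k" for k using Qi res(3)[OF i] by (cases "k = a") auto
    have "(\<Sum>k\<in>I. u' i k) \<le> (M + d) * l i" unfolding sumI using Qi by (simp add: algebra_simps)
    also have "\<dots> \<le> (M + d) * real (6 * card I ^ 9)"
      using res(2)[OF i] w by (intro mult_left_mono) (auto simp: M_def simp del: of_nat_mult of_nat_power)
    finally show "(\<Sum>k\<in>I. u' i k) \<le> 6 * real (card I) ^ 9 * (w + 2 * real (card I))"
      by (simp add: M_def d_def algebra_simps)
    show "0 \<le> \<kappa> * s' i" using res(5)[OF i] \<kappa> by simp
  next
    show "generates I u' A" by (rule res)
    show "y k = (\<Sum>i\<in>I. \<kappa> * s' i * u' i k)" for k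
      using res(6)[of k] \<kappa> by (simp add: field_simps flip: sum_distrib_left)
  qed
qed

section \<open>Covering cones by induction on the dimension\<close>

fun cover_weight :: "nat \<Rightarrow> nat" where
  "cover_weight 0 = 0"
| "cover_weight (Suc n) = 6 * Suc n ^ 9 * (cover_weight n + 2 * Suc n)"

text \<open>The outer induction is on the dimension, the inner one on the number of light points. A
  nonzero lattice point of weight less than 1 in the orthant permits a star subdivision; without one
  the quotient argument applies.\<close>

lemma cone_cover:
  fixes A :: "('i \<Rightarrow> real) set"
  assumes "finite I" "lattice_on I A" "\<And>k. 0 \<le> y k" "\<And>k. k \<notin> I \<Longrightarrow> y k = 0"
  shows "cone_covered I A (cover_weight (card I)) y"
  using assms
proof (induction "card I" arbitrary: I A y)
  case 0
  then have "I = {}" by simp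
  moreover have "z k = 0" if "z \<in> A" for z k
    using lattice_supp[OF \<open>lattice_on I A\<close> that] \<open>I = {}\<close> by auto
  ultimately show ?case using 0 by (simp add: cone_covered_def generates_def)
next
  case (Suc n)
  note outer = Suc.hyps(1)
  have fin: "finite I" and card: "card I = Suc n" using Suc by auto
  from Suc.prems(2-4) show ?case
  proof (induction "card (light_points I A)" arbitrary: A y rule: less_induct)
    case less
    note lat = less.prems(1) and y = less.prems(2,3)
    show ?case
    proof (cases "\<exists>x\<in>A. (\<forall>k\<in>I. 0 \<le> x k) \<and> (\<exists>k\<in>I. x k \<noteq> 0) \<and> (\<Sum>k\<in>I. x k) < 1")
      case True
      then obtain x where x: "x \<in> A" "\<forall>k\<in>I. 0 \<le> x k" "\<exists>k\<in>I. x k \<noteq> 0" "(\<Sum>k\<in>I. x k) < 1" by blast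
      have x0: "0 \<le> x k" for k using x(2) lattice_supp[OF lat x(1), of k] by (cases "k \<in> I") auto
      let ?S = "{k \<in> I. x k > 0}"
      have "finite ?S" "?S \<noteq> {}" using fin x x0 by (auto simp: less_le)
      then obtain i where i: "i \<in> ?S" "\<And>k. k \<in> ?S \<Longrightarrow> y i / x i \<le> y k / x k"
        using ex_min_if_finite[of "(\<lambda>k. y k / x k) ` ?S"] by (force simp: not_less)
      show ?thesis
      proof (rule cone_covered_star[OF fin lat x(1) x0])
        show "0 < x i" "i \<in> I" using i by auto
        show "y i / x i \<le> y k / x k" if "k \<in> I" "x k > 0" for k using i(2)[of k] that by simp
      qed (use x y less.hyps in blast)+
    next
      case False
      have "finite (y ` I)" "y ` I \<noteq> {}" using fin card by auto
      then have "Max (y ` I) \<in> y ` I" by (rule Max_in)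
      then obtain a0 where "a0 \<in> I" "y a0 = Max (y ` I)" by auto
      then have a0: "a0 \<in> I" "\<And>k. k \<in> I \<Longrightarrow> y k \<le> y a0" using fin by auto
      have key: "cone_covered I A (cover_weight (card I)) v"
        if a: "a \<in> I" and v: "\<And>k. 0 \<le> v k" "\<And>k. k \<notin> I \<Longrightarrow> v k = 0" "\<And>k. k \<in> I \<Longrightarrow> v k \<le> v a" "0 < v a"
        for v a
      proof -
        have "cone_covered (I - {a}) ((\<lambda>z. z(a := 0)) ` A) (cover_weight (card (I - {a}))) (v(a := 0))"
          by (rule outer) (use fin card a v lattice_on_quotient[OF fin lat a] in auto)
        moreover have "card (I - {a}) = n" using fin card a by simp
        ultimately have "cone_covered I A
            (6 * real (card I) ^ 9 * (real (cover_weight n) + 2 * real (card I))) v"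
          using False fin lat a v by (intro cone_covered_empty) (force simp: not_less)+
        moreover have "real (cover_weight (card I)) =
            6 * real (card I) ^ 9 * (real (cover_weight n) + 2 * real (card I))"
          unfolding card by (simp add: algebra_simps)
        ultimately show ?thesis by (simp only:)
      qed
      show ?thesis
      proof (cases "y a0 = 0")
        case True
        then have y0: "y k = 0" for k using a0 y by (metis order_antisym)
        \<comment> \<open>The origin still needs admissible generators; they are borrowed from the
          point \<open>unit a0\<close> and given coefficients 0.\<close>
        have "cone_covered I A (cover_weight (card I)) (unit a0)"
          by (rule key[OF a0(1)]) (use a0 in \<open>auto simp: unit_def\<close>)
        then obtain u :: "'i \<Rightarrow> 'i \<Rightarrow> real" and s :: "'i \<Rightarrow> real" where "\<forall>i\<in>I. u i \<in> A \<and> (\<forall>k. 0 \<le> u i k) \<and> (\<Sum>k\<in>I. u i k) \<le> cover_weight (card I)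
           \<and> 0 \<le> s i" "generates I u A" unfolding cone_covered_def by blast
        then show ?thesis unfolding cone_covered_def
          by (intro exI[of _ u] exI[of _ "\<lambda>_. 0"]) (auto simp: y0)
      next
        case False
        then have "0 < y a0" using y(1)[of a0] by linarith
        then show ?thesis using key[OF a0(1), of y] y a0 by blast
      qed
    qed
  qed
qed

section \<open>Full-dimensional simplices in a polytope\<close>

interpretation fun_vs: vector_space "\<lambda>r (f :: nat \<Rightarrow> real). (\<lambda>i. r * f i)"
  by unfold_locales (auto simp: fun_eq_iff algebra_simps)

lemma sum_fun_apply: "(\<Sum>v\<in>S. (g v :: nat \<Rightarrow> real)) k = (\<Sum>v\<in>S. g v k)"
  by (induction S rule: infinite_finite_induct) auto

text \<open>Subtracting a multiple of a linear relation until the first coefficient vanishes keeps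
  all coefficients nonnegative and drops one vector.\<close>

lemma conic_caratheodory:
  fixes D :: "(nat \<Rightarrow> real) set"
  assumes "finite D" "\<forall>v\<in>D. 0 \<le> c v"
  shows "\<exists>S c'. S \<subseteq> D \<and> \<not> fun_vs.dependent S \<and> (\<forall>v\<in>S. 0 \<le> c' v) \<and>
    (\<forall>k. (\<Sum>v\<in>D. c v * v k) = (\<Sum>v\<in>S. c' v * v k))"
  using assms
proof (induction "card D" arbitrary: D c rule: less_induct)
  case less
  show ?case
  proof (cases "fun_vs.dependent D")
    case True
    then obtain u0 w where u0: "w \<in> D" "u0 w \<noteq> 0" "(\<Sum>v\<in>D. (\<lambda>i. u0 v * v i)) = 0"
      using fun_vs.dependent_finite[OF less.prems(1)] by auto
    \<comment> \<open>The sign is chosen so that the relation has a positive entry, over which the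
      minimal ratio \<open>c m / u m\<close> can be taken.\<close>
    define u where "u = (\<lambda>v. if u0 w > 0 then u0 v else - u0 v)"
    have u: "u w > 0" using u0(2) by (simp add: u_def)
    have u_sum: "(\<Sum>v\<in>D. u v * v k) = 0" for k
      using fun_cong[OF u0(3), of k]
      by (cases "u0 w > 0") (simp_all add: u_def sum_fun_apply sum_negf)
    let ?S = "{v \<in> D. u v > 0}"
    have "finite ?S" "?S \<noteq> {}" using less.prems u u0 by auto
    then obtain m where m: "m \<in> ?S" "\<And>v. v \<in> ?S \<Longrightarrow> c m / u m \<le> c v / u v"
      using ex_min_if_finite[of "(\<lambda>v. c v / u v) ` ?S"] by (force simp: not_less)
    define c' where "c' = (\<lambda>v. c v - c m / u m * u v)"
    have c'0: "0 \<le> c' v" if v: "v \<in> D" for v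
    proof (cases "u v > 0")
      case True
      then show ?thesis using m(2)[of v] v by (simp add: c'_def field_simps)
    next
      case False
      moreover have "0 \<le> c m / u m" using m less.prems by simp
      ultimately have "c m / u m * u v \<le> 0" by (intro mult_nonneg_nonpos) auto
      then show ?thesis using less.prems(2) v unfolding c'_def by fastforce
    qed
    have "c' m = 0" using m by (simp add: c'_def)
    have eq: "(\<Sum>v\<in>D. c v * v k) = (\<Sum>v\<in>D - {m}. c' v * v k)" for k
    proof -
      have "(\<Sum>v\<in>D. c' v * v k) = (\<Sum>v\<in>D. c v * v k) - c m / u m * (\<Sum>v\<in>D. u v * v k)"
        by (simp add: c'_def algebra_simps sum_subtractf sum_distrib_left)
      then have "(\<Sum>v\<in>D. c v * v k) = (\<Sum>v\<in>D. c' v * v k)" using u_sum by simp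
      also have "\<dots> = (\<Sum>v\<in>D - {m}. c' v * v k)"
        using less.prems m \<open>c' m = 0\<close> by (subst sum.remove[of _ m]) auto
      finally show ?thesis .
    qed
    have "card (D - {m}) < card D" using less.prems m by (intro psubset_card_mono) auto
    from less.hyps[OF this, of c'] less.prems c'0
    obtain S c'' where "S \<subseteq> D - {m}" "\<not> fun_vs.dependent S" "\<forall>v\<in>S. 0 \<le> c'' v"
       "\<forall>k. (\<Sum>v\<in>D - {m}. c' v * v k) = (\<Sum>v\<in>S. c'' v * v k)" by auto
    then show ?thesis using eq by (intro exI[of _ S] exI[of _ c'']) auto
  qed (use less.prems in blast)
qed

text \<open>An independent set carrying \<open>z\<close> is extended within \<open>V\<close> to one
  that spans; the added vertices get coefficient 0. So \<open>z\<close> lies in a full-dimensional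
  simplex even if it belongs to a lower-dimensional face.\<close>

lemma full_dim_simplex:
  assumes V: "finite V" "V \<subseteq> Rd d" and full: "full_dim d (conv V)" and z: "z \<in> conv V"
  obtains B t where "B \<subseteq> V" "card B = Suc d" "\<And>b. b \<in> B \<Longrightarrow> 0 \<le> t b" "(\<Sum>b\<in>B. t b) = 1"
    "\<And>k. z k = (\<Sum>b\<in>B. t b * b k)"
    "\<And>a. (\<Sum>b\<in>B. a b) = 0 \<Longrightarrow> \<forall>k. (\<Sum>b\<in>B. a b * b k) = 0 \<Longrightarrow> \<forall>b\<in>B. a b = (0::real)"
    "\<And>x. x \<in> Rd d \<Longrightarrow> \<exists>a. (\<Sum>b\<in>B. a b) = 0 \<and> (\<forall>k. x k = (\<Sum>b\<in>B. a b * b k))"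
proof -
  txt \<open>Homogenisation: affine notions in \<open>R^d\<close> become linear ones for the vectors \<open>v(d := 1)\<close>.\<close>
  define h :: "(nat \<Rightarrow> real) \<Rightarrow> nat \<Rightarrow> real" where "h = (\<lambda>v. v(d := 1))"
  have inj: "inj_on h (Rd d)"
    unfolding h_def inj_on_def Rd_def
    by (metis (mono_tags, lifting) fun_upd_idem_iff fun_upd_upd mem_Collect_eq order_refl)
  have VRd: "v k = 0" if "v \<in> V" "k \<ge> d" for v k using V that by (auto simp: Rd_def)
  define E where "E = (\<lambda>i k. if k = i then (1::real) else 0) ` {..d}"
  have E: "finite E" "card E \<le> Suc d" unfolding E_def by (auto intro: order_trans[OF card_image_le])
  have RdE: "x \<in> fun_vs.span E" if "x \<in> Rd (Suc d)" for x
  proof -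
    have "x = (\<Sum>i\<le>d. (\<lambda>k. x i * (if k = i then 1 else 0)))"
      using that by (auto simp: sum_fun_apply fun_eq_iff Rd_def if_distrib Suc_le_eq not_le cong: if_cong)
    also have "\<dots> \<in> fun_vs.span E"
      by (intro fun_vs.span_sum fun_vs.span_scale fun_vs.span_base) (auto simp: E_def)
    finally show ?thesis .
  qed
  have hRd: "h v \<in> Rd (Suc d)" if "v \<in> Rd d" for v using that by (auto simp: h_def Rd_def)
  have conv_h: "h p \<in> fun_vs.span (h ` V)" "p \<in> Rd d" if "p \<in> conv V" for p
  proof -
    obtain c where c: "(\<Sum>v\<in>V. c v) = 1" "p = (\<lambda>i. \<Sum>v\<in>V. c v * v i)"
      using \<open>p \<in> conv V\<close> unfolding conv_def by blast
    have "h p = (\<Sum>v\<in>V. (\<lambda>i. c v * h v i))"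
      using c VRd by (auto simp: h_def fun_eq_iff sum_fun_apply)
    also have "\<dots> \<in> fun_vs.span (h ` V)"
      by (intro fun_vs.span_sum fun_vs.span_scale fun_vs.span_base) auto
    finally show "h p \<in> fun_vs.span (h ` V)" .
    show "p \<in> Rd d" using c VRd by (auto simp: Rd_def intro!: sum.neutral)
  qed
  from full obtain p0 w where w: "p0 \<in> conv V" "\<And>j. j < d \<Longrightarrow> w j \<in> conv V"
    "\<And>a. (\<forall>i<d. (\<Sum>j<d. a j * (w j i - p0 i)) = 0) \<Longrightarrow> \<forall>j<d. a j = 0"
    unfolding full_dim_def by blast
  define q where "q = (\<lambda>j. if j < d then w j else p0)"
  have q: "q j \<in> conv V" for j using w by (auto simp: q_def)
  have qRd: "q j \<in> Rd d" for j using conv_h(2)[OF q] .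
  have q_indep: "a j = 0" if a: "\<And>k. (\<Sum>j\<le>d. a j * h (q j) k) = 0" and j: "j \<le> d" for a :: "nat \<Rightarrow> real" and j
  proof -
    have split: "(\<Sum>j\<le>d. f j) = (\<Sum>j<d. f j) + f d" for f :: "nat \<Rightarrow> real"
      by (simp flip: lessThan_Suc_atMost)
    \<comment> \<open>The homogenising coordinate \<open>d\<close> yields that the coefficients sum
      to 0, which turns the linear relation into one between the differences
      \<open>w j - p0\<close>.\<close>
    have s0: "(\<Sum>j<d. a j) = - a d" using a[of d] by (simp add: split h_def)
    have "(\<Sum>j<d. a j * (w j i - p0 i)) = 0" if "i < d" for i
    proof -
      have "(\<Sum>j<d. a j * (w j i - p0 i)) = (\<Sum>j<d. a j * w j i) - (\<Sum>j<d. a j) * p0 i"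
        by (simp add: algebra_simps sum_subtractf sum_distrib_left)
      also have "\<dots> = (\<Sum>j\<le>d. a j * h (q j) i)"
        using that s0 by (simp add: split h_def q_def)
      finally show ?thesis using a by simp
    qed
    then have "\<forall>j<d. a j = 0" using w(3)[of a] by blast
    then show ?thesis using s0 j by (cases "j = d") auto
  qed
  have q_inj: "inj_on (\<lambda>j. h (q j)) {..d}"
  proof
    fix i j assume ij: "i \<in> {..d}" "j \<in> {..d}" "h (q i) = h (q j)"
    show "i = j"
    proof (rule ccontr)
      assume "i \<noteq> j"
      define a where "a = (\<lambda>k. if k = i then 1 else if k = j then -1 else (0::real))"
      have "(\<Sum>l\<le>d. a l * h (q l) k) = 0" for k
      proof -
        have "(\<Sum>l\<le>d. a l * h (q l) k) = (\<Sum>l\<le>d. (if l = i then h (q l) k else 0) - (if l = j then h (q l) k else 0))"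
          using \<open>i \<noteq> j\<close> by (intro sum.cong) (auto simp: a_def)
        also have "\<dots> = 0" using ij by (simp add: sum_subtractf)
        finally show ?thesis .
      qed
      from q_indep[OF this, of i] ij show False by (simp add: a_def)
    qed
  qed
  define W where "W = (\<lambda>j. h (q j)) ` {..d}"
  have W: "finite W" "card W = Suc d" using card_image[OF q_inj] by (auto simp: W_def)
  have W_indep: "\<not> fun_vs.dependent W"
  proof
    assume "fun_vs.dependent W"
    then obtain c v where c: "v \<in> W" "c v \<noteq> 0" "(\<Sum>v\<in>W. (\<lambda>i. c v * v i)) = 0"
      using fun_vs.dependent_finite[OF W(1)] by auto
    have "(\<Sum>j\<le>d. c (h (q j)) * h (q j) k) = 0" for k
      using fun_cong[OF c(3), of k] unfolding W_def
      by (simp add: sum_fun_apply sum.reindex[OF q_inj])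
    from q_indep[of "\<lambda>j. c (h (q j))", OF this] c show False by (auto simp: W_def)
  qed
  have WE: "W \<subseteq> fun_vs.span E" using hRd qRd RdE by (auto simp: W_def)
  \<comment> \<open>Dimension count: \<open>W\<close> has \<open>d + 1\<close> independent members
    inside the span of the at most \<open>d + 1\<close> vectors \<open>E\<close>.\<close>
  have span_max: "x \<in> fun_vs.span S" if S: "W \<subseteq> fun_vs.span S" and x: "x \<in> Rd (Suc d)" for x S
  proof (rule ccontr)
    assume "x \<notin> fun_vs.span S"
    then have xW: "x \<notin> fun_vs.span W" using S fun_vs.span_minimal[OF S fun_vs.subspace_span] by blast
    then have "\<not> fun_vs.dependent (insert x W)" using W_indep by (simp add: fun_vs.independent_insert)
    then have "card (insert x W) \<le> card E"
      using fun_vs.independent_span_bound[OF E(1), of "insert x W"] WE RdE[OF x] by auto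
    moreover have "x \<notin> W" using xW fun_vs.span_base by auto
    ultimately show False using W E by simp
  qed
  have W_V: "W \<subseteq> fun_vs.span (h ` V)" using conv_h(1)[OF q] by (auto simp: W_def)
  obtain c where c: "\<forall>v\<in>V. 0 \<le> c v" "(\<Sum>v\<in>V. c v) = 1" "z = (\<lambda>i. \<Sum>v\<in>V. c v * v i)"
    using z unfolding conv_def by blast
  have inv: "the_inv_into V h (h v) = v" if "v \<in> V" for v
    by (rule the_inv_into_f_f) (use that inj V inj_on_subset in blast)+
  have injV: "inj_on h V" using inj V inj_on_subset by blast
  have hz: "h z k = (\<Sum>v\<in>h ` V. c (the_inv_into V h v) * v k)" for k
  proof -
    have "(\<Sum>v\<in>h ` V. c (the_inv_into V h v) * v k) = (\<Sum>v\<in>V. c v * h v k)"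
      by (simp add: sum.reindex[OF injV] inv cong: sum.cong)
    also have "\<dots> = h z k" using c VRd by (auto simp: h_def)
    finally show ?thesis ..
  qed
  have cn: "\<forall>v\<in>h ` V. 0 \<le> c (the_inv_into V h v)" using c inv by auto
  obtain S c' where S: "S \<subseteq> h ` V" "\<not> fun_vs.dependent S" "\<forall>v\<in>S. 0 \<le> c' v"
    "\<forall>k. (\<Sum>v\<in>h ` V. c (the_inv_into V h v) * v k) = (\<Sum>v\<in>S. c' v * v k)"
    using conic_caratheodory[of "h ` V" "\<lambda>v. c (the_inv_into V h v)", OF finite_imageI[OF V(1)] cn]
    by (elim exE conjE)
  obtain H where H: "S \<subseteq> H" "H \<subseteq> h ` V" "\<not> fun_vs.dependent H" "h ` V \<subseteq> fun_vs.span H"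
    using fun_vs.maximal_independent_subset_extend[OF S(1,2)] by blast
  have finH: "finite H" using H V finite_subset by blast
  have W_H: "W \<subseteq> fun_vs.span H"
    using W_V fun_vs.span_minimal[OF H(4) fun_vs.subspace_span] by blast
  have HE: "H \<subseteq> fun_vs.span E" using H(2) V hRd RdE by blast
  have "card H \<le> card E" using fun_vs.independent_span_bound[OF E(1) H(3) HE] by simp
  moreover have "card W \<le> card H" using fun_vs.independent_span_bound[OF finH W_indep W_H] by simp
  ultimately have cardH: "card H = Suc d" using W E by simp
  obtain B where B: "B \<subseteq> V" "H = h ` B" using H(2) subset_image_iff by metis
  have injB: "inj_on h B" using B injV inj_on_subset by blast
  have hd: "h v d = 1" "\<And>k. k \<noteq> d \<Longrightarrow> h v k = v k" for v by (auto simp: h_def)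
  have Bd: "b d = 0" if "b \<in> B" for b using VRd B that by auto
  define t where "t = (\<lambda>b. if h b \<in> S then c' (h b) else 0)"
  have ht: "h z k = (\<Sum>b\<in>B. t b * h b k)" for k
  proof -
    have "h z k = (\<Sum>v\<in>S. c' v * v k)" using S hz by simp
    also have "\<dots> = (\<Sum>v\<in>H. (if v \<in> S then c' v else 0) * v k)"
      using finH H(1) by (intro sum.mono_neutral_cong_left) auto
    finally show ?thesis unfolding B by (simp add: sum.reindex[OF injB] t_def)
  qed
  show ?thesis
  proof (rule that[of B t])
    show "B \<subseteq> V" by (rule B)
    show "card B = Suc d" using cardH card_image[OF injB] B by simp
    show "0 \<le> t b" for b using S by (simp add: t_def)
    show "(\<Sum>b\<in>B. t b) = 1" using ht[of d] by (simp add: hd)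
    show "z k = (\<Sum>b\<in>B. t b * b k)" for k
      using ht[of k] conv_h(2)[OF z] Bd by (cases "k = d") (auto simp: hd Rd_def sum.neutral)
  next
    fix a :: "(nat \<Rightarrow> real) \<Rightarrow> real"
    assume a: "(\<Sum>b\<in>B. a b) = 0" "\<forall>k. (\<Sum>b\<in>B. a b * b k) = 0"
    have hB: "the_inv_into B h (h b) = b" if "b \<in> B" for b by (rule the_inv_into_f_f[OF injB that])
    have "(\<Sum>b\<in>B. a b * h b k) = 0" for k using a by (cases "k = d") (auto simp: hd)
    then have "(\<Sum>v\<in>H. (\<lambda>i. a (the_inv_into B h v) * v i)) = 0"
      unfolding B by (simp add: fun_eq_iff sum_fun_apply sum.reindex[OF injB] hB cong: sum.cong)
    from fun_vs.independentD[OF H(3) finH order_refl this] show "\<forall>b\<in>B. a b = 0"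
      using hB B(2) by (metis imageI)
  next
    fix x assume x: "x \<in> Rd d"
    then have "x \<in> Rd (Suc d)" by (auto simp: Rd_def)
    then have "x \<in> fun_vs.span H" by (rule span_max[OF W_H])
    then obtain a where a: "x = (\<Sum>v\<in>H. (\<lambda>i. a v * v i))" unfolding fun_vs.span_finite[OF finH] by auto
    have xk: "x k = (\<Sum>b\<in>B. a (h b) * h b k)" for k
      using fun_cong[OF a, of k] unfolding B by (simp add: sum_fun_apply sum.reindex[OF injB])
    have xd: "x d = 0" using x by (simp add: Rd_def)
    show "\<exists>a. (\<Sum>b\<in>B. a b) = 0 \<and> (\<forall>k. x k = (\<Sum>b\<in>B. a b * b k))"
    proof (intro exI[of _ "\<lambda>b. a (h b)"] conjI allI)
      show "(\<Sum>b\<in>B. a (h b)) = 0" using xk[of d] xd by (simp add: hd)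
      show "x k = (\<Sum>b\<in>B. a (h b) * b k)" for k
        using xk[of k] xd Bd by (cases "k = d") (auto simp: hd sum.neutral)
    qed
  qed
qed

section \<open>From cones to polytopes\<close>

text \<open>Abel summation, which translates between the edges of a lattice path and its
  vertices.\<close>

lemma sum_by_parts:
  fixes g H :: "nat \<Rightarrow> real"
  shows "(\<Sum>j<n. (g j - g (Suc j)) * H (Suc j))
       = (\<Sum>j<n. g j * (H (Suc j) - H j)) - g n * H n + g 0 * H 0"
  by (induction n) (auto simp: algebra_simps)

text \<open>Since \<open>conv\<close> sums over a set of points, the coefficients of coinciding
  \<open>p j\<close> have to be merged.\<close>

lemma conv_image:
  assumes "finite J" "\<And>j. j \<in> J \<Longrightarrow> 0 \<le> \<theta> j" "(\<Sum>j\<in>J. \<theta> j) = 1"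
  shows "(\<lambda>k. \<Sum>j\<in>J. \<theta> j * p j k) \<in> conv (p ` J)"
proof -
  define w where "w = (\<lambda>v. \<Sum>j\<in>{j \<in> J. p j = v}. \<theta> j)"
  have "0 \<le> w v" for v unfolding w_def by (rule sum_nonneg) (use assms in auto)
  moreover have "(\<Sum>v\<in>p ` J. w v) = 1"
    using sum.image_gen[OF assms(1), of \<theta> p] assms(3) by (simp add: w_def)
  moreover have "(\<Sum>j\<in>J. \<theta> j * p j k) = (\<Sum>v\<in>p ` J. w v * v k)" for k
  proof -
    have "(\<Sum>j\<in>J. \<theta> j * p j k) = (\<Sum>v\<in>p ` J. \<Sum>j\<in>{j \<in> J. p j = v}. \<theta> j * p j k)"
      by (rule sum.image_gen[OF assms(1)])
    then show ?thesis by (simp add: w_def sum_distrib_right)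
  qed
  ultimately show ?thesis unfolding conv_def by blast
qed

lemma conv_subset_dilate:
  assumes "finite T" "T \<subseteq> dilate c (conv V)"
  shows "conv T \<subseteq> dilate c (conv V)"
proof
  fix x assume "x \<in> conv T"
  then obtain w where w: "\<forall>t\<in>T. 0 \<le> w t" "(\<Sum>t\<in>T. w t) = 1" "x = (\<lambda>i. \<Sum>t\<in>T. w t * t i)"
    unfolding conv_def by blast
  have "\<forall>t\<in>T. \<exists>m. (\<forall>v\<in>V. 0 \<le> m v) \<and> (\<Sum>v\<in>V. m v) = 1 \<and> t = (\<lambda>i. c * (\<Sum>v\<in>V. m v * v i))"
    using assms(2) unfolding dilate_def conv_def by fastforce
  from bchoice[OF this] obtain m where "\<forall>t\<in>T. (\<forall>v\<in>V. 0 \<le> m t v) \<and> (\<Sum>v\<in>V. m t v) = 1 \<and>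
      t = (\<lambda>i. c * (\<Sum>v\<in>V. m t v * v i))" ..
  then have m: "\<And>t v. t \<in> T \<Longrightarrow> v \<in> V \<Longrightarrow> 0 \<le> m t v" "\<And>t. t \<in> T \<Longrightarrow> (\<Sum>v\<in>V. m t v) = 1"
    "\<And>t i. t \<in> T \<Longrightarrow> t i = c * (\<Sum>v\<in>V. m t v * v i)"
    by (blast, blast, metis)
  define l where "l = (\<lambda>v. \<Sum>t\<in>T. w t * m t v)"
  have "0 \<le> l v" if "v \<in> V" for v unfolding l_def by (intro sum_nonneg mult_nonneg_nonneg) (use w m that in auto)
  moreover have "(\<Sum>v\<in>V. l v) = 1"
    unfolding l_def by (subst sum.swap) (simp add: m(2) w(2) flip: sum_distrib_left)
  moreover have "x = (\<lambda>i. c * (\<Sum>v\<in>V. l v * v i))"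
  proof
    fix i
    have "x i = (\<Sum>t\<in>T. w t * (c * (\<Sum>v\<in>V. m t v * v i)))"
      unfolding w(3) by (intro sum.cong refl arg_cong2[of _ _ _ _ "(*)"] m(3))
    also have "\<dots> = c * (\<Sum>t\<in>T. \<Sum>v\<in>V. w t * m t v * v i)"
      by (simp add: sum_distrib_left mult_ac)
    also have "\<dots> = c * (\<Sum>v\<in>V. l v * v i)"
      unfolding l_def by (subst sum.swap) (simp add: sum_distrib_right)
    finally show "x i = c * (\<Sum>v\<in>V. l v * v i)" .
  qed
  ultimately show "x \<in> dilate c (conv V)" unfolding dilate_def conv_def
    by (intro image_eqI[of _ _ "\<lambda>i. \<Sum>v\<in>V. l v * v i"]) blast+
qed

lemma finite_lattice_box: "finite {z \<in> lattice_pts d. \<forall>k<d. \<bar>z k\<bar> \<le> R}"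
proof (rule finite_subset)
  show "{z \<in> lattice_pts d. \<forall>k<d. \<bar>z k\<bar> \<le> R}
     \<subseteq> {z. \<forall>k. (k \<in> {..<d} \<longrightarrow> z k \<in> {x \<in> \<int>. \<bar>x\<bar> \<le> R}) \<and> (k \<notin> {..<d} \<longrightarrow> z k = 0)}"
    by (auto simp: lattice_pts_def Rd_def)
  show "finite \<dots>" by (intro finite_set_of_finite_funs finite_abs_int_segment) auto
qed

section \<open>Alcoves of a unimodular cone\<close>

lemma lattice_pts_add_sum:
  assumes "x \<in> lattice_pts d" "\<And>i. i \<in> I \<Longrightarrow> U i \<in> lattice_pts d" "\<And>i. i \<in> I \<Longrightarrow> m i \<in> \<int>"
  shows "(\<lambda>k. x k + (\<Sum>i\<in>I. m i * U i k)) \<in> lattice_pts d"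
  using assms unfolding lattice_pts_def Rd_def by (auto intro!: Ints_add Ints_sum Ints_mult sum.neutral)

text \<open>The vertices of the alcove containing the point are reached by adding the generators in the order of
  decreasing fractional parts of the coefficients.\<close>
lemma alcove_simplex:
  fixes U :: "'i \<Rightarrow> nat \<Rightarrow> real"
  assumes fin: "finite I" and card: "card I = d"
    and U: "\<And>i. i \<in> I \<Longrightarrow> U i \<in> lattice_pts d" "generates I U (lattice_pts d)"
    and o': "o' \<in> lattice_pts d" and s: "\<And>i. i \<in> I \<Longrightarrow> 0 \<le> s i"
  obtains T where "finite T" "unimodular_simplex d (conv T)" "(\<lambda>k. o' k + (\<Sum>i\<in>I. s i * U i k)) \<in> conv T"
    "\<And>p. p \<in> T \<Longrightarrow> \<exists>m. (\<forall>i\<in>I. 0 \<le> m i \<and> m i \<le> s i + 1) \<and> p = (\<lambda>k. o' k + (\<Sum>i\<in>I. m i * U i k))"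
proof -
  define r where "r = (\<lambda>i. frac (s i))"
  obtain xs where xs: "set xs = I" "distinct xs" using finite_distinct_list[OF fin] by auto
  define ys where "ys = sort_key (\<lambda>i. - r i) xs"
  have ys: "set ys = I" "distinct ys" "sorted (map (\<lambda>i. - r i) ys)" using xs by (auto simp: ys_def)
  have len: "length ys = d" using distinct_card[OF ys(2)] ys(1) card by simp
  define \<sigma> where "\<sigma> = (\<lambda>j. ys ! j)"
  have bij: "bij_betw \<sigma> {..<d} I"
    unfolding \<sigma>_def using bij_betw_nth[OF ys(2), of "{..<d}" I] ys(1) len by auto
  have sumI: "(\<Sum>i\<in>I. f i) = (\<Sum>j<d. f (\<sigma> j))" for f :: "'i \<Rightarrow> real"
    by (rule sum.reindex_bij_betw[OF bij, symmetric])
  have \<sigma>I: "\<sigma> j \<in> I" if "j < d" for j using bij that by (auto simp: bij_betw_def)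
  \<comment> \<open>The value 0 from \<open>d\<close> on makes the boundary term of the summation by
    parts vanish; \<open>e\<close> below is extended in the same way.\<close>
  define g where "g = (\<lambda>j. if j < d then r (\<sigma> j) else 0)"
  have g01: "0 \<le> g j" "g j \<le> 1" for j
    by (auto simp: g_def r_def frac_ge_0 less_imp_le[OF frac_lt_1])
  have gd: "g (Suc j) \<le> g j" for j
  proof (cases "Suc j < d")
    case True
    then have "map (\<lambda>i. - r i) ys ! j \<le> map (\<lambda>i. - r i) ys ! Suc j"
      using ys(3) len by (intro sorted_nth_mono) auto
    then show ?thesis using True len by (simp add: g_def \<sigma>_def)
  qed (use g01 in \<open>auto simp: g_def\<close>)
  define P where "P = (\<lambda>j k. o' k + (\<Sum>i\<in>I. of_int \<lfloor>s i\<rfloor> * U i k) + (\<Sum>l<j. U (\<sigma> l) k))"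
  have PS: "P (Suc j) k - P j k = U (\<sigma> j) k" for j k by (simp add: P_def)
  define T where "T = P ` {..d}"
  have P_alt: "P j = (\<lambda>k. o' k + (\<Sum>i\<in>I. (of_int \<lfloor>s i\<rfloor> + (if i \<in> \<sigma> ` {..<j} then 1 else 0)) * U i k))"
    if "j \<le> d" for j
  proof
    fix k
    have inj: "inj_on \<sigma> {..<j}" using bij that by (auto simp: bij_betw_def intro: inj_on_subset)
    have "(\<Sum>l<j. U (\<sigma> l) k) = (\<Sum>i\<in>\<sigma> ` {..<j}. U i k)" by (simp add: sum.reindex[OF inj])
    also have "\<dots> = (\<Sum>i\<in>I. (if i \<in> \<sigma> ` {..<j} then 1 else 0) * U i k)"
      using fin \<sigma>I that by (intro sum.mono_neutral_cong_left) auto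
    finally show "P j k = o' k + (\<Sum>i\<in>I. (of_int \<lfloor>s i\<rfloor> + (if i \<in> \<sigma> ` {..<j} then 1 else 0)) * U i k)"
      by (simp add: P_def distrib_right sum.distrib)
  qed
  have P_lat: "P j \<in> lattice_pts d" if "j \<le> d" for j
    unfolding P_alt[OF that] by (rule lattice_pts_add_sum) (use o' U in auto)
  have T_alt: "T = insert (P 0) ((\<lambda>j. P (Suc j)) ` {..<d})"
    unfolding T_def by (auto simp: image_iff) (metis Suc_pred lessThan_iff Suc_le_eq not_gr0)
  show ?thesis
  proof (rule that[of T])
    show "finite T" by (simp add: T_def)
    show "unimodular_simplex d (conv T)"
      unfolding unimodular_simplex_def
    proof (intro exI[of _ "P 0"] exI[of _ "\<lambda>j. P (Suc j)"] conjI allI impI ballI)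
      show "P 0 \<in> lattice_pts d" "\<And>j. j < d \<Longrightarrow> P (Suc j) \<in> lattice_pts d" by (auto intro: P_lat)
      show "conv T = conv (insert (P 0) ((\<lambda>j. P (Suc j)) ` {..<d}))" by (simp add: T_alt)
      fix z assume "z \<in> lattice_pts d"
      then obtain c :: "'i \<Rightarrow> int" where c: "\<forall>k. z k = (\<Sum>i\<in>I. of_int (c i) * U i k)"
        using U(2) unfolding generates_def by blast
      define e where "e = (\<lambda>j. if j < d then c (\<sigma> j) else 0)"
      have "z i = (\<Sum>j<d. of_int (e j - e (Suc j)) * (P (Suc j) i - P 0 i))" for i
      proof -
        have "z i = (\<Sum>j<d. of_int (e j) * ((P (Suc j) i - P 0 i) - (P j i - P 0 i)))"
          using c PS[of _ i] unfolding sumI by (simp add: e_def)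
        also have "\<dots> = (\<Sum>j<d. (of_int (e j) - of_int (e (Suc j))) * (P (Suc j) i - P 0 i))"
          unfolding sum_by_parts[of "\<lambda>j. of_int (e j)" "\<lambda>j. P j i - P 0 i"] by (simp add: e_def)
        finally show ?thesis by simp
      qed
      then show "\<exists>k::nat \<Rightarrow> int. \<forall>i<d. z i = (\<Sum>j<d. of_int (k j) * (P (Suc j) i - P 0 i))"
        by (intro exI[of _ "\<lambda>j. e j - e (Suc j)"]) blast
    qed
    \<comment> \<open>The barycentric coordinates in the alcove: successive differences of the
      sequence \<open>1, g 0, ..., g (d - 1), 0\<close>, nonnegative as it decreases.\<close>
    define \<theta> where "\<theta> = case_nat (1 - g 0) (\<lambda>j. g j - g (Suc j))"
    have \<theta>_sum: "(\<Sum>j\<le>d. \<theta> j * h j) = (1 - g 0) * h 0 + (\<Sum>j<d. (g j - g (Suc j)) * h (Suc j))" for h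
      unfolding sum.atMost_shift by (simp add: \<theta>_def)
    have "(\<lambda>k. \<Sum>j\<le>d. \<theta> j * P j k) \<in> conv T"
      unfolding T_def
    proof (rule conv_image)
      show "0 \<le> \<theta> j" for j using g01 gd by (auto simp: \<theta>_def split: nat.split)
      show "(\<Sum>j\<le>d. \<theta> j) = 1"
        using \<theta>_sum[of "\<lambda>_. 1"] sum_by_parts[of g "\<lambda>_. 1" d] by (simp add: g_def)
    qed simp
    also have "(\<lambda>k. \<Sum>j\<le>d. \<theta> j * P j k) = (\<lambda>k. o' k + (\<Sum>i\<in>I. s i * U i k))"
    proof
      fix k
      have "(\<Sum>j\<le>d. \<theta> j * P j k) = P 0 k + (\<Sum>j<d. g j * U (\<sigma> j) k)"
        unfolding \<theta>_sum sum_by_parts[of g "\<lambda>j. P j k"] PS by (simp add: g_def algebra_simps)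
      also have "(\<Sum>j<d. g j * U (\<sigma> j) k) = (\<Sum>i\<in>I. r i * U i k)" unfolding sumI by (simp add: g_def)
      also have "P 0 k + (\<Sum>i\<in>I. r i * U i k) = o' k + (\<Sum>i\<in>I. s i * U i k)"
        by (simp add: P_def r_def frac_def algebra_simps sum_subtractf)
      finally show "(\<Sum>j\<le>d. \<theta> j * P j k) = o' k + (\<Sum>i\<in>I. s i * U i k)" .
    qed
    finally show "(\<lambda>k. o' k + (\<Sum>i\<in>I. s i * U i k)) \<in> conv T" .
  next
    fix p assume "p \<in> T"
    then obtain j where j: "j \<le> d" "p = P j" by (auto simp: T_def)
    define m where "m = (\<lambda>i. real_of_int \<lfloor>s i\<rfloor> + (if i \<in> \<sigma> ` {..<j} then 1 else 0))"
    have "0 \<le> m i \<and> m i \<le> s i + 1" if "i \<in> I" for i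
    proof -
      have "0 \<le> real_of_int \<lfloor>s i\<rfloor>" "real_of_int \<lfloor>s i\<rfloor> \<le> s i" using s[OF that] by auto
      then show ?thesis unfolding m_def by (smt (verit))
    qed
    moreover have "p = (\<lambda>k. o' k + (\<Sum>i\<in>I. m i * U i k))"
      unfolding j(2) m_def by (rule P_alt[OF j(1)])
    ultimately show "\<exists>m. (\<forall>i\<in>I. 0 \<le> m i \<and> m i \<le> s i + 1) \<and> p = (\<lambda>k. o' k + (\<Sum>i\<in>I. m i * U i k))"
      by (intro exI[of _ m]) simp
  qed
qed

text \<open>A simplex containing the point has a vertex \<open>v0\<close> with barycentric
  coordinate at least \<open>1 / (d + 1)\<close>. In the cone at \<open>v0\<close> the point is then
  so far from the opposite facet of the dilated simplex that the alcove around it cannot cross that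
  facet.\<close>

lemma polytope_unimodular_cover:
  assumes P: "lattice_polytope d P" and c: "real c \<ge> real (d * (d + 1) * cover_weight d)"
    and c0: "real c > 0"
  shows "dilate (real c) P = UC d (dilate (real c) P)"
proof -
  obtain V where V: "finite V" "V \<subseteq> lattice_pts d" "P = conv V" and full: "full_dim d P"
    using P unfolding lattice_polytope_def by blast
  have VRd: "V \<subseteq> Rd d" using V by (auto simp: lattice_pts_def)
  have "x \<in> UC d (dilate (real c) P)" if xP: "x \<in> dilate (real c) P" for x
  proof -
    obtain z where z: "z \<in> conv V" "x = (\<lambda>i. real c * z i)"
      using xP unfolding V(3) dilate_def by blast
    obtain B t where B: "B \<subseteq> V" "card B = Suc d" "\<And>b. b \<in> B \<Longrightarrow> 0 \<le> t b" "(\<Sum>b\<in>B. t b) = 1"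
      "\<And>k. z k = (\<Sum>b\<in>B. t b * b k)"
      and indep: "\<And>a. (\<Sum>b\<in>B. a b) = 0 \<Longrightarrow> \<forall>k. (\<Sum>b\<in>B. a b * b k) = 0 \<Longrightarrow> \<forall>b\<in>B. a b = (0::real)"
      and spans: "\<And>x. x \<in> Rd d \<Longrightarrow> \<exists>a. (\<Sum>b\<in>B. a b) = 0 \<and> (\<forall>k. x k = (\<Sum>b\<in>B. a b * b k))"
      by (rule full_dim_simplex[OF V(1) VRd full[unfolded V(3)] z(1)]) (rule that)
    have finB: "finite B" using B V finite_subset by blast
    have "\<exists>v0\<in>B. t v0 \<ge> 1 / real (Suc d)"
    proof (rule ccontr)
      assume "\<not> ?thesis"
      then have "(\<Sum>b\<in>B. t b) < (\<Sum>b\<in>B. 1 / real (Suc d))"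
        using finB B(2) by (intro sum_strict_mono) auto
      then show False using B by simp
    qed
    then obtain v0 where v0: "v0 \<in> B" "t v0 \<ge> 1 / real (Suc d)" by blast
    define I where "I = B - {v0}"
    have I: "finite I" "v0 \<notin> I" "B = insert v0 I" "card I = d"
      using finB v0 B by (auto simp: I_def)
    have sumB: "(\<Sum>b\<in>B. f b) = f v0 + (\<Sum>b\<in>I. f b)" for f :: "(nat \<Rightarrow> real) \<Rightarrow> real"
      using I by simp
    \<comment> \<open>The map from coordinates with respect to the edges at \<open>v0\<close> to
      vectors. The lattice \<open>A\<close> below is the preimage of the integer points.\<close>
    define D where "D = (\<lambda>a k. \<Sum>b\<in>I. a b * (b k - v0 k) :: real)"
    have D_lin: "D (\<lambda>b. (\<Sum>i\<in>J. m i * u i b)) k = (\<Sum>i\<in>J. m i * D (u i) k)"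
      for J :: "(nat \<Rightarrow> real) set" and m and u :: "(nat \<Rightarrow> real) \<Rightarrow> (nat \<Rightarrow> real) \<Rightarrow> real" and k
    proof -
      have "D (\<lambda>b. (\<Sum>i\<in>J. m i * u i b)) k = (\<Sum>b\<in>I. \<Sum>i\<in>J. m i * (u i b * (b k - v0 k)))"
        by (simp add: D_def sum_distrib_right mult.assoc)
      also have "\<dots> = (\<Sum>i\<in>J. \<Sum>b\<in>I. m i * (u i b * (b k - v0 k)))" by (rule sum.swap)
      finally show ?thesis by (simp add: D_def sum_distrib_left)
    qed
    have D_aff: "D a k = (\<Sum>b\<in>I. a b * b k) - (\<Sum>b\<in>I. a b) * v0 k" for a k
      by (simp add: D_def algebra_simps sum_subtractf sum_distrib_left)
    have D_inj: "a = a'" if "D a = D a'" "\<forall>b. b \<notin> I \<longrightarrow> a b = 0" "\<forall>b. b \<notin> I \<longrightarrow> a' b = 0" for a a'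
    proof
      fix b
      define e where "e = (\<lambda>b. if b = v0 then - (\<Sum>b\<in>I. a b - a' b) else a b - a' b)"
      have eI: "(\<Sum>b\<in>I. e b * f b) = (\<Sum>b\<in>I. (a b - a' b) * f b)" for f
        using I by (intro sum.cong) (auto simp: e_def)
      have e0: "(\<Sum>b\<in>B. e b) = 0" using eI[of "\<lambda>_. 1"] unfolding sumB by (simp add: e_def)
      have e1: "(\<Sum>b\<in>B. e b * b k) = 0" for k :: nat
        unfolding sumB eI using fun_cong[OF that(1), of k] D_aff[of a k] D_aff[of a' k]
        by (simp add: e_def algebra_simps sum_subtractf)
      show "a b = a' b"
      proof (cases "b \<in> I")
        case True
        then have "e b = 0" using indep[OF e0] e1 I by blast
        moreover have "b \<noteq> v0" using True I by blast
        ultimately show ?thesis by (simp add: e_def)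
      qed (use that in simp)
    qed
    have lat_diff: "(\<lambda>k. b k - v0 k) \<in> lattice_pts d" if "b \<in> B" for b
    proof -
      have "b \<in> lattice_pts d" "v0 \<in> lattice_pts d" using that B V v0 by auto
      then show ?thesis by (auto simp: lattice_pts_def Rd_def)
    qed
    define A where "A = {a. (\<forall>b. b \<notin> I \<longrightarrow> a b = 0) \<and> D a \<in> lattice_pts d}"
    have lat: "lattice_on I A"
      unfolding lattice_on_def
    proof (intro conjI ballI allI impI)
      show "a b = 0" if "a \<in> A" "b \<notin> I" for a b using that by (auto simp: A_def)
    next
      fix a a' assume a: "a \<in> A" "a' \<in> A"
      have "D (\<lambda>b. a b - a' b) = (\<lambda>k. D a k - D a' k)" by (auto simp: D_def algebra_simps sum_subtractf)
      then show "(\<lambda>b. a b - a' b) \<in> A" using a by (auto simp: A_def lattice_pts_def Rd_def)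
    next
      fix b assume b: "b \<in> I"
      have "D (unit b) = (\<lambda>k. b k - v0 k)"
        using b I by (auto simp: D_def unit_def if_distrib[of "\<lambda>x. x * _"] cong: if_cong)
      then show "unit b \<in> A" using lat_diff[of b] b I by (auto simp: A_def unit_def)
    next
      fix R
      define R' where "R' = (\<Sum>b\<in>I. \<Sum>k<d. R * \<bar>b k - v0 k\<bar>)"
      have "D ` {a \<in> A. \<forall>b\<in>I. \<bar>a b\<bar> \<le> R} \<subseteq> {z \<in> lattice_pts d. \<forall>k<d. \<bar>z k\<bar> \<le> R'}"
      proof
        fix z assume "z \<in> D ` {a \<in> A. \<forall>b\<in>I. \<bar>a b\<bar> \<le> R}"
        then obtain a where a: "z = D a" "a \<in> A" "\<forall>b\<in>I. \<bar>a b\<bar> \<le> R" by blast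
        have "\<bar>D a k\<bar> \<le> R'" if k: "k < d" for k
        proof -
          have "\<bar>D a k\<bar> \<le> (\<Sum>b\<in>I. \<bar>a b * (b k - v0 k)\<bar>)" unfolding D_def by (rule sum_abs)
          also have "\<dots> \<le> R'" unfolding R'_def
          proof (rule sum_mono)
            fix b assume b: "b \<in> I"
            then have R: "0 \<le> R" "\<bar>a b\<bar> \<le> R" using a(3) by force+
            then have "\<bar>a b * (b k - v0 k)\<bar> \<le> R * \<bar>b k - v0 k\<bar>"
              unfolding abs_mult by (intro mult_right_mono) auto
            also have "\<dots> \<le> (\<Sum>k<d. R * \<bar>b k - v0 k\<bar>)"
              using k R by (intro member_le_sum) auto
            finally show "\<bar>a b * (b k - v0 k)\<bar> \<le> (\<Sum>k<d. R * \<bar>b k - v0 k\<bar>)" .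
          qed
          finally show ?thesis .
        qed
        then show "z \<in> {z \<in> lattice_pts d. \<forall>k<d. \<bar>z k\<bar> \<le> R'}" using a by (auto simp: A_def)
      qed
      then have "finite (D ` {a \<in> A. \<forall>b\<in>I. \<bar>a b\<bar> \<le> R})"
        using finite_lattice_box finite_subset by blast
      moreover have "inj_on D {a \<in> A. \<forall>b\<in>I. \<bar>a b\<bar> \<le> R}"
        by (intro inj_onI D_inj) (auto simp: A_def)
      ultimately show "finite {a \<in> A. \<forall>b\<in>I. \<bar>a b\<bar> \<le> R}" by (rule finite_imageD)
    qed
    define y where "y = (\<lambda>b. if b \<in> I then real c * t b else 0)"
    have "cone_covered I A (cover_weight (card I)) y"
      by (rule cone_cover[OF I(1) lat]) (use B(3) I(3) in \<open>auto simp: y_def\<close>)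
    then obtain u s where u: "\<forall>i\<in>I. u i \<in> A \<and> (\<forall>b. 0 \<le> u i b) \<and> (\<Sum>b\<in>I. u i b) \<le> cover_weight d \<and> 0 \<le> s i"
      "generates I u A" "\<forall>b. y b = (\<Sum>i\<in>I. s i * u i b)"
      unfolding cone_covered_def I(4) by auto
    define o' where "o' = (\<lambda>k. real c * v0 k)"
    have ID: "i \<in> I \<Longrightarrow> D (u i) \<in> lattice_pts d" for i using u(1) by (auto simp: A_def)
    have gen: "generates I (\<lambda>i. D (u i)) (lattice_pts d)"
      unfolding generates_def
    proof
      fix w assume w: "w \<in> lattice_pts d"
      then have "w \<in> Rd d" by (simp add: lattice_pts_def)
      then obtain a where a: "(\<Sum>b\<in>B. a b) = 0" "\<forall>k. w k = (\<Sum>b\<in>B. a b * b k)" using spans by blast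
      define a' where "a' = (\<lambda>b. if b \<in> I then a b else 0)"
      have wD: "w = D a'"
      proof
        fix k
        have "D a' k = D a k" unfolding D_def by (rule sum.cong) (auto simp: a'_def)
        also have "(\<Sum>b\<in>I. a b) = - a v0" using a(1) unfolding sumB by simp
        then have "D a k = w k" using a(2) unfolding D_aff sumB by simp
        finally show "w k = D a' k" ..
      qed
      then have "a' \<in> A" using w by (auto simp: A_def a'_def)
      then obtain g :: "(nat \<Rightarrow> real) \<Rightarrow> int" where g: "\<forall>b. a' b = (\<Sum>i\<in>I. of_int (g i) * u i b)"
        using u(2) unfolding generates_def by blast
      then have "a' = (\<lambda>b. \<Sum>i\<in>I. of_int (g i) * u i b)" by auto
      then have "\<forall>k. w k = (\<Sum>i\<in>I. of_int (g i) * D (u i) k)" unfolding wD by (simp only: D_lin) simp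
      then show "\<exists>g::(nat \<Rightarrow> real) \<Rightarrow> int. \<forall>k. w k = (\<Sum>i\<in>I. of_int (g i) * D (u i) k)" by blast
    qed
    have o': "o' \<in> lattice_pts d"
      using v0 B V by (auto simp: o'_def lattice_pts_def Rd_def intro!: Ints_mult)
    obtain T where T: "finite T" "unimodular_simplex d (conv T)"
      "(\<lambda>k. o' k + (\<Sum>i\<in>I. s i * D (u i) k)) \<in> conv T"
      "\<And>p. p \<in> T \<Longrightarrow> \<exists>m. (\<forall>i\<in>I. 0 \<le> m i \<and> m i \<le> s i + 1) \<and> p = (\<lambda>k. o' k + (\<Sum>i\<in>I. m i * D (u i) k))"
      by (rule alcove_simplex[OF I(1,4) ID gen o', of s]) (use u(1) in auto)
    have yI: "(\<Sum>b\<in>I. y b * f b) = real c * (\<Sum>b\<in>I. t b * f b)" for f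
      by (simp add: y_def sum_distrib_left mult.assoc cong: sum.cong)
    have t_I: "(\<Sum>b\<in>I. t b) = 1 - t v0" using B(4) unfolding sumB by simp
    have "x = (\<lambda>k. o' k + (\<Sum>i\<in>I. s i * D (u i) k))"
    proof
      fix k
      have "y = (\<lambda>b. \<Sum>i\<in>I. s i * u i b)" using u(3) by auto
      then have "(\<Sum>i\<in>I. s i * D (u i) k) = D y k" by (simp only: D_lin)
      also have "\<dots> = real c * (\<Sum>b\<in>I. t b * b k) - real c * (1 - t v0) * v0 k"
        unfolding D_aff yI using yI[of "\<lambda>_. 1"] t_I by simp
      finally show "x k = o' k + (\<Sum>i\<in>I. s i * D (u i) k)"
        unfolding z(2) B(5) sumB by (simp add: o'_def algebra_simps)
    qed
    with T(3) have xT: "x \<in> conv T" by simp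
    have "T \<subseteq> dilate (real c) (conv V)"
    proof
      fix p assume "p \<in> T"
      then obtain m where m: "\<forall>i\<in>I. 0 \<le> m i \<and> m i \<le> s i + 1" "p = (\<lambda>k. o' k + (\<Sum>i\<in>I. m i * D (u i) k))"
        using T(4) by blast
      define a where "a = (\<lambda>b. \<Sum>i\<in>I. m i * u i b)"
      have a0: "0 \<le> a b" for b unfolding a_def using m u by (intro sum_nonneg mult_nonneg_nonneg) auto
      have "(\<Sum>b\<in>I. a b) = (\<Sum>i\<in>I. m i * (\<Sum>b\<in>I. u i b))"
        unfolding a_def by (subst sum.swap) (simp add: sum_distrib_left)
      also have "\<dots> \<le> (\<Sum>i\<in>I. (s i + 1) * (\<Sum>b\<in>I. u i b))"
        using m u by (intro sum_mono mult_right_mono sum_nonneg) auto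
      also have "\<dots> = (\<Sum>i\<in>I. s i * (\<Sum>b\<in>I. u i b)) + (\<Sum>i\<in>I. \<Sum>b\<in>I. u i b)"
        by (simp add: algebra_simps sum.distrib)
      finally have 1: "(\<Sum>b\<in>I. a b) \<le> (\<Sum>i\<in>I. s i * (\<Sum>b\<in>I. u i b)) + (\<Sum>i\<in>I. \<Sum>b\<in>I. u i b)" .
      have "(\<Sum>i\<in>I. s i * (\<Sum>b\<in>I. u i b)) = (\<Sum>i\<in>I. \<Sum>b\<in>I. s i * u i b)"
        by (simp add: sum_distrib_left)
      also have "\<dots> = (\<Sum>b\<in>I. y b)" using u(3) by (subst sum.swap) simp
      also have "\<dots> = real c * (1 - t v0)" using yI[of "\<lambda>_. 1"] t_I by simp
      finally have 2: "(\<Sum>i\<in>I. s i * (\<Sum>b\<in>I. u i b)) = real c * (1 - t v0)" .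
      have 3: "(\<Sum>i\<in>I. \<Sum>b\<in>I. u i b) \<le> real (card I) * cover_weight d"
        using u by (intro sum_bounded_above) auto
      \<comment> \<open>The alcove exceeds the weight \<open>c * (1 - t v0)\<close> of the point by
        at most \<open>d * cover_weight d\<close>, and the slack
        \<open>c * t v0 \<ge> c / (d + 1)\<close> absorbs this.\<close>
      have "real c * t v0 \<ge> real c * (1 / real (Suc d))" using v0 by (intro mult_left_mono) auto
      moreover have "real c * (1 / real (Suc d)) \<ge> real d * cover_weight d"
        using c by (simp add: field_simps)
      moreover have "real c * (1 - t v0) = real c - real c * t v0" by (simp add: algebra_simps)
      ultimately have ac: "(\<Sum>b\<in>I. a b) \<le> real c" using 1 2 3 I(4) by simp
      \<comment> \<open>Barycentric coordinates of \<open>p / c\<close>: the apex \<open>v0\<close>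
        takes what the other vertices leave.\<close>
      define w where "w = (\<lambda>b. if b = v0 then 1 - (\<Sum>b\<in>I. a b) / c else if b \<in> I then a b / c else 0)"
      have wB: "(\<Sum>b\<in>V. w b * f b) = w v0 * f v0 + (\<Sum>b\<in>I. a b / c * f b)" for f
      proof -
        have "(\<Sum>b\<in>V. w b * f b) = (\<Sum>b\<in>B. w b * f b)"
          using V B I by (intro sum.mono_neutral_right) (auto simp: w_def)
        also have "\<dots> = w v0 * f v0 + (\<Sum>b\<in>I. a b / c * f b)"
          unfolding sumB using I(2) by (intro arg_cong2[of _ _ _ _ "(+)"] sum.cong) (auto simp: w_def)
        finally show ?thesis .
      qed
      have pk: "p k = real c * (\<Sum>b\<in>V. w b * b k)" for k
      proof -
        have "p k = o' k + D a k" unfolding m(2) a_def D_lin ..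
        then show ?thesis unfolding wB D_aff using c0
          by (simp add: w_def o'_def algebra_simps sum_divide_distrib[symmetric])
      qed
      show "p \<in> dilate (real c) (conv V)"
        unfolding dilate_def conv_def
      proof (rule image_eqI[of _ _ "\<lambda>k. \<Sum>b\<in>V. w b * b k"])
        show "p = (\<lambda>i. real c * (\<Sum>b\<in>V. w b * b i))" using pk by auto
        have "\<forall>v\<in>V. 0 \<le> w v" using a0 ac c0 by (auto simp: w_def)
        moreover have "(\<Sum>v\<in>V. w v) = 1" using wB[of "\<lambda>_. 1"] by (simp add: w_def sum_divide_distrib)
        ultimately show "(\<lambda>k. \<Sum>b\<in>V. w b * b k) \<in> {x. \<exists>u. (\<forall>v\<in>V. 0 \<le> u v) \<and> (\<Sum>v\<in>V. u v) = 1 \<and>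
            x = (\<lambda>i. \<Sum>v\<in>V. u v * v i)}" by blast
      qed
    qed
    then have "conv T \<subseteq> dilate (real c) P" unfolding V(3) by (rule conv_subset_dilate[OF T(1)])
    then show ?thesis using xT T(2) unfolding UC_def by blast
  qed
  then show ?thesis unfolding UC_def by blast
qed

section \<open>The numerical bound\<close>

text \<open>Carrying the summand \<open>2 * Suc n\<close> turns the affine recursion into a
  multiplicative one with factor at most \<open>8 * N ^ 9\<close>.\<close>

lemma cover_weight_le:
  assumes "n \<le> N"
  shows "cover_weight n + 2 * Suc n \<le> 2 * (8 * N ^ 9) ^ n"
  using assms
proof (induction n)
  case (Suc n)
  let ?a = "cover_weight n + 2 * Suc n"
  have "cover_weight (Suc n) + 2 * Suc (Suc n) \<le> 6 * Suc n ^ 9 * ?a + 2 * ?a" by simp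
  also have "\<dots> \<le> 6 * Suc n ^ 9 * ?a + 2 * Suc n ^ 9 * ?a"
    by (intro add_left_mono mult_right_mono) auto
  also have "\<dots> = 8 * Suc n ^ 9 * ?a" by (simp only: flip: distrib_right) simp
  also have "\<dots> \<le> (8 * N ^ 9) * (2 * (8 * N ^ 9) ^ n)"
    using Suc by (intro mult_mono power_mono) auto
  finally show ?case by (simp add: mult_ac)
qed simp

text \<open>The logarithm of the left side grows like \<open>9 * d * ln d\<close>, that of the right
  side at least like a constant times \<open>d powr (3/2)\<close>.\<close>

lemma cover_bound_asymp:
  "\<forall>\<^sub>F d :: nat in sequentially. real (d * (d + 1) * cover_weight d)
     \<le> (3/2) ^ (nat \<lceil>sqrt (real d - 1)\<rceil> * (d - 1))"
proof -
  have "\<forall>\<^sub>F d :: nat in sequentially. real d * (real d + 1) * (2 * (8 * real d ^ 9) powr real d)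
     \<le> (3/2) powr (sqrt (real d - 1) * (real d - 1))"
    by real_asymp
  then show ?thesis
    using eventually_gt_at_top[of 1]
  proof eventually_elim
    case (elim d)
    have "cover_weight d \<le> 2 * (8 * d ^ 9) ^ d" using cover_weight_le[of d d] by linarith
    then have "real (d * (d + 1) * cover_weight d) \<le> real (d * (d + 1) * (2 * (8 * d ^ 9) ^ d))"
      by (intro of_nat_mono mult_left_mono) auto
    also have "\<dots> = real d * (real d + 1) * (2 * (8 * real d ^ 9) powr real d)"
      using elim by (simp add: powr_realpow algebra_simps)
    also have "\<dots> \<le> (3/2) powr (sqrt (real d - 1) * (real d - 1))" by (rule elim)
    also have "\<dots> \<le> (3/2) powr real (nat \<lceil>sqrt (real d - 1)\<rceil> * (d - 1))"
    proof (rule powr_mono)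
      have "sqrt (real d - 1) * (real d - 1) \<le> real (nat \<lceil>sqrt (real d - 1)\<rceil>) * (real d - 1)"
        using elim by (intro mult_right_mono real_nat_ceiling_ge) auto
      then show "sqrt (real d - 1) * (real d - 1) \<le> real (nat \<lceil>sqrt (real d - 1)\<rceil> * (d - 1))"
        using elim by (simp add: of_nat_diff)
    qed simp
    also have "\<dots> = (3/2) ^ (nat \<lceil>sqrt (real d - 1)\<rceil> * (d - 1))" by (rule powr_realpow) simp
    finally show ?case .
  qed
qed

section \<open>Finiteness and the absolute constant\<close>

lemma cpol_le:
  assumes "d > 0"
  obtains c where "cpol d = enat c" "c \<le> d * (d + 1) * cover_weight d"
proof -
  let ?c = "d * (d + 1) * cover_weight d"
  have "?c > 0" using assms by (cases d) auto
  have "dilate (real c') P = UC d (dilate (real c') P)" if "lattice_polytope d P" "c' \<ge> ?c" for P c'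
  proof (rule polytope_unimodular_cover[OF that(1)])
    show "real ?c \<le> real c'" using that(2) by (rule of_nat_mono)
    show "0 < real c'" using less_le_trans[OF \<open>?c > 0\<close> that(2)] by (simp only: of_nat_0_less_iff)
  qed
  then have "cpol d \<le> enat ?c" unfolding cpol_def by (intro Inf_lower) blast
  then show ?thesis using that enat_ile by force
qed

theorem theorem1p1:
  shows "\<exists>K::real. K > 0 \<and> (\<forall>d::nat. d > 1 \<longrightarrow>
           (\<exists>c::nat. cpol d = enat c \<and>
              real c \<le> K * real d ^ 5 * (3/2) ^ (nat \<lceil>sqrt (real d - 1)\<rceil> * (d - 1))))"
proof -
  define c0 where "c0 = (\<lambda>d. d * (d + 1) * cover_weight d)"
  define R where "R = (\<lambda>d. (3/2 :: real) ^ (nat \<lceil>sqrt (real d - 1)\<rceil> * (d - 1)))"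
  obtain N where N: "\<And>d. d \<ge> N \<Longrightarrow> real (c0 d) \<le> R d"
    using cover_bound_asymp unfolding eventually_sequentially c0_def R_def by blast
  \<comment> \<open>The sum absorbs the finitely many dimensions below the asymptotic range.\<close>
  define K where "K = 1 + (\<Sum>d<N. real (c0 d))"
  have K1: "K \<ge> 1" unfolding K_def by (simp add: sum_nonneg)
  have main: "real (c0 d) \<le> K * real d ^ 5 * R d" if d: "d > 1" for d
  proof -
    have R1: "1 \<le> R d" unfolding R_def by (rule one_le_power) simp
    have "real (c0 d) \<le> K * R d"
    proof (cases "d < N")
      case True
      then have "real (c0 d) \<le> K" unfolding K_def
        by (intro order_trans[OF member_le_sum[of d "{..<N}" "\<lambda>d. real (c0 d)"]]) auto
      also have "\<dots> \<le> K * R d" using K1 R1 by simp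
      finally show ?thesis .
    next
      case False
      then have "real (c0 d) \<le> 1 * R d" using N by simp
      also have "\<dots> \<le> K * R d" using K1 R1 by (intro mult_right_mono) auto
      finally show ?thesis .
    qed
    also have "\<dots> \<le> K * real d ^ 5 * R d"
      using K1 R1 d by (intro mult_right_mono) auto
    finally show ?thesis .
  qed
  show ?thesis
  proof (intro exI[of _ K] conjI allI impI)
    show "K > 0" using K1 by simp
    fix d :: nat assume d: "d > 1"
    then obtain c where c: "cpol d = enat c" "c \<le> c0 d" using cpol_le[of d] by (auto simp: c0_def)
    then have "real c \<le> real (c0 d)" by simp
    also note main[OF d]
    finally show "\<exists>c::nat. cpol d = enat c \<and>
        real c \<le> K * real d ^ 5 * (3/2) ^ (nat \<lceil>sqrt (real d - 1)\<rceil> * (d - 1))"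
      using c unfolding R_def by blast
  qed
qed

end
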